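(* In the quadratic setting (loss $\ell(y,\theta^Tx)=\frac12(y-\theta^Tx)^2$), assume: (i) $(X_t,y_t)_{t\ge1}$ are i.i.d. copies of $(X,y)\in\mathcal X\times\mathcal Y$, $\mathbb E[XX^T]$ is positive definite and $\|x\|\le D_X$ for all $x\in\mathcal X$; (ii) there is $\theta^*\in\mathbb R^d$ with $L(\theta^* )=\inf_{\theta\in\mathbb R^d}L(\theta)$; (iii) there exists $\sigma^2>0$ such that for any $s\in\mathbb R$, $\mathbb E[e^{s(y-\mathbb E[y\mid X])}\mid X]\le e^{\sigma^2s^2/2}$ a.s., and there exists $D_{\rm app}\ge0$ such that $|\mathbb E[y\mid X]-\theta^{*T}X|\le D_{\rm app}$ a.s.; (iv) for any $\delta,\varepsilon>0$ there exists $\tau(\varepsilon,\delta)\in\mathbb N$ such that, with probability at least $1-\delta$, $\|\hat\theta_t-\theta^*\|\le\varepsilon$ holds simultaneously for all $t>\tau(\varepsilon,\delta)$. Then for any $\delta>0$ and any $\varepsilon>0$, with probability at least $1-5\delta$, it holds simultaneously for all $n\ge1$ that $$\begin{aligned}\sum_{t=\tau(\varepsilon,\delta)+1}^{\tau(\varepsilon,\delta)+n}\big(L(\hat\theta_t)-L(\theta^* )\big)\le{}&\frac{15}2\,d\left(8\sigma^2+D_{\rm app}^2+\varepsilon^2D_X^2\right)\ln\!\left(1+n\frac{\lambda_{\max}(P_1)D_X^2}{d}\right)+5\lambda_{\max}\!\left(P_{\tau(\varepsilon,\delta)+1}^{-1}\right)\varepsilon^2\\&+115\left(\sigma^2\Big(4+\frac{\lambda_{\max}(P_1)D_X^2}{4}\Big)+D_{\rm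 app}^2+2\varepsilon^2D_X^2\right)\ln\delta^{-1}.\end{aligned}$$
   Context: Let $d\ge1$, $\mathcal X\subset\mathbb R^d$, $\mathcal Y\subset\mathbb R$; $\|\cdot\|$ is the Euclidean norm and $\lambda_{\max}$ the largest eigenvalue. The risk is $L(\theta)=\mathbb E[\ell(y,\theta^TX)]=\frac12\mathbb E[(y-\theta^TX)^2]$. The estimates $\hat\theta_t$ and matrices $P_t$ are produced by the static (extended) Kalman filter: $P_1$ is any (deterministic) positive definite matrix, $\hat\theta_1\in\mathbb R^d$ any (deterministic) vector, and for $t=1,2,\dots$ $$P_{t+1}=P_t-\frac{P_tX_tX_t^TP_t}{1+X_t^TP_tX_t},\qquad\hat\theta_{t+1}=\hat\theta_t+P_{t+1}(y_t-\hat\theta_t^TX_t)X_t.$$ *)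

theory Defs
  imports "HOL-Probability.Probability"
begin

definition outer :: "real ^ 'd \<Rightarrow> real ^ 'd ^ 'd" where
  "outer x = (columnvector x :: real ^ 1 ^ 'd) ** (rowvector x :: real ^ 'd ^ 1)"

definition pos_def :: "real ^ 'd ^ 'd \<Rightarrow> bool" where
  "pos_def A \<longleftrightarrow> transpose A = A \<and> (\<forall>v. v \<noteq> 0 \<longrightarrow> 0 < v \<bullet> (A *v v))"

definition is_eigenvalue :: "real ^ 'd ^ 'd \<Rightarrow> real \<Rightarrow> bool" where
  "is_eigenvalue A l \<longleftrightarrow> (\<exists>v. v \<noteq> 0 \<and> A *v v = l *\<^sub>R v)"

(* Meaningful for symmetric A (all of whose eigenvalues are real); only used there. *)
definition lambda_max :: "real ^ 'd ^ 'd \<Rightarrow> real" where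
  "lambda_max A = (GREATEST l. is_eigenvalue A l)"

definition quad_loss :: "real \<Rightarrow> real \<Rightarrow> real" where
  "quad_loss y z = (y - z)\<^sup>2 / 2"

definition risk :: "'w measure \<Rightarrow> ('w \<Rightarrow> real ^ 'd) \<Rightarrow> ('w \<Rightarrow> real) \<Rightarrow> real ^ 'd \<Rightarrow> real" where
  "risk M X y \<theta> = (\<integral>\<omega>. quad_loss (y \<omega>) (\<theta> \<bullet> X \<omega>) \<partial>M)"

definition sigma_of :: "'w measure \<Rightarrow> ('w \<Rightarrow> real ^ 'd) \<Rightarrow> 'w measure" where
  "sigma_of M X = vimage_algebra (space M) X borel"

definition cond_mean :: "'w measure \<Rightarrow> ('w \<Rightarrow> real ^ 'd) \<Rightarrow> ('w \<Rightarrow> real) \<Rightarrow> 'w \<Rightarrow> real" where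
  "cond_mean M X y = real_cond_exp M (sigma_of M X) y"

(* The exponential moment is a conditional expectation in [0,\<infinity>]: real_cond_exp would
   return 0 where that value is infinite and make the bound hold vacuously.
   Together with boundedness of cond_mean - \<theta> \<bullet> X and of X, this condition forces y to be
   square integrable, so that cond_mean and risk are then the genuine expectations. *)
definition cond_subgaussian ::
  "'w measure \<Rightarrow> ('w \<Rightarrow> real ^ 'd) \<Rightarrow> ('w \<Rightarrow> real) \<Rightarrow> real \<Rightarrow> bool" where
  "cond_subgaussian M X y \<sigma> \<longleftrightarrow>
     (\<forall>s. AE \<omega> in M.
        nn_cond_exp M (sigma_of M X) (\<lambda>\<omega>'. ennreal (exp (s * (y \<omega>' - cond_mean M X y \<omega>')))) \<omega>
          \<le> ennreal (exp (\<sigma>\<^sup>2 * s\<^sup>2 / 2)))"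

(* Sequences are indexed from 1; their values at index 0 are unconstrained and never used. *)
definition static_kalman ::
  "real ^ 'd ^ 'd \<Rightarrow> real ^ 'd \<Rightarrow> (nat \<Rightarrow> real ^ 'd) \<Rightarrow> (nat \<Rightarrow> real) \<Rightarrow>
   (nat \<Rightarrow> real ^ 'd ^ 'd) \<Rightarrow> (nat \<Rightarrow> real ^ 'd) \<Rightarrow> bool" where
  "static_kalman P1 \<theta>1 x y P \<theta> \<longleftrightarrow>
     P 1 = P1 \<and> \<theta> 1 = \<theta>1 \<and>
     (\<forall>t\<ge>1.
        P (t + 1) = P t - (1 / (1 + x t \<bullet> (P t *v x t))) *\<^sub>R (P t ** outer (x t) ** P t) \<and>
        \<theta> (t + 1) = \<theta> t + P (t + 1) *v ((y t - \<theta> t \<bullet> x t) *\<^sub>R x t))"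

(* The observations (Xs t, ys t), t \<ge> 1, are independent copies of (X, y). *)
definition iid_copies ::
  "'w measure \<Rightarrow> (nat \<Rightarrow> 'w \<Rightarrow> real ^ 'd) \<Rightarrow> (nat \<Rightarrow> 'w \<Rightarrow> real) \<Rightarrow>
   ('w \<Rightarrow> real ^ 'd) \<Rightarrow> ('w \<Rightarrow> real) \<Rightarrow> bool" where
  "iid_copies M Xs ys X y \<longleftrightarrow>
     prob_space.indep_vars M (\<lambda>_. borel) (\<lambda>t \<omega>. (Xs t \<omega>, ys t \<omega>)) {1..} \<and>
     (\<forall>t\<ge>1. distr M borel (\<lambda>\<omega>. (Xs t \<omega>, ys t \<omega>)) = distr M borel (\<lambda>\<omega>. (X \<omega>, y \<omega>)))"

end

theory Submission
  imports Defs
begin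

text \<open>Write \<open>e = \<theta>h t - \<theta>s\<close>, \<open>u = e \<bullet> Xs t\<close>, \<open>\<rho> = ys t - \<theta>s \<bullet> Xs t\<close> and \<open>v = Xs t \<bullet> (P (t + 1) *v Xs t)\<close>.
  The energy \<open>e \<bullet> (matrix_inv (P t) *v e)\<close> drops by exactly \<open>u\<^sup>2 - 2 \<rho> u - (\<rho> - u)\<^sup>2 v\<close> in each step, and
  the gains \<open>v\<close> sum to at most a ratio of log-determinants, which simultaneous diagonalization and
  \<open>ln\<close>-concavity bound by \<open>d ln (1 + n \<lambda> DX\<^sup>2 / d)\<close>. The excess risk is \<open>E[(e \<bullet> X)\<^sup>2] / 2\<close>, so it remains to
  control the sum of \<open>E[(e \<bullet> X)\<^sup>2] - 5 u\<^sup>2 + 10 \<rho> u + 5 (\<rho> - u)\<^sup>2 v - 15 (8 \<sigma>\<^sup>2 + Dapp\<^sup>2 + \<epsilon>\<^sup>2 DX\<^sup>2) v\<close>.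
  Divided by \<open>K = 230 (4 \<sigma>\<^sup>2 + Dapp\<^sup>2 + 2 \<epsilon>\<^sup>2 DX\<^sup>2)\<close>, these terms have exponential moment at most 1
  given the past whenever \<open>norm e \<le> \<epsilon>\<close>: the sub-Gaussian noise contributes a factor absorbed by
  \<open>u\<^sup>2\<close> and \<open>120 \<sigma>\<^sup>2 v\<close>, and what is left is bounded with mean \<open>-3 E[(e \<bullet> X)\<^sup>2]\<close>, since the first-order
  condition at \<open>\<theta>s\<close> makes the bias orthogonal to \<open>X\<close>. Ville's inequality then bounds all partial
  sums at once by \<open>K ln (1 / \<delta>)\<close>.\<close>

section \<open>Symmetric matrices\<close>

text \<open>Three obstacles shape the proof. The sub-Gaussian bound holds for each fixed
  \<open>s\<close> off a null set that depends on \<open>s\<close>, whereas exponents varying with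
  \<open>X\<close> are required, together with a term quadratic in the noise because the gain
  multiplies the squared residual. Closeness to \<open>\<theta>s\<close> at all late times cannot be
  read off the past; increments are therefore set to zero at states outside the
  \<open>\<epsilon>\<close>-ball, which gives an exponential bound from every state, and on the
  event of assumption (iv) this cut never acts after the time
  \<open>\<tau> \<epsilon> \<delta>\<close>. Finally, conditioning on the past is replaced by
  Fubini: the state is a fixed function of finitely many independent inputs.

  The weight 5 on the energy identity is spent as 1 + 1 + 3: one \<open>u\<^sup>2\<close> pays for
  the noise, one offsets the second moment itself, and three remain as drift against second-order
  terms. The 15 is 5 times the 3 in the bound on the square of a sum of three terms (noise, bias,
  \<open>u\<close>), and \<open>K / 2\<close> is the source of 115.\<close>

lemma linear_coeff_zero_if_quadratic_nonneg:
  fixes a b :: real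
  assumes nonneg: "\<And>s. 0 \<le> s * b + s\<^sup>2 * a"
  shows "b = 0"
proof (rule ccontr)
  assume "b \<noteq> 0"
  \<comment> \<open>At \<open>s = - (b * t)\<close> the quadratic equals
    \<open>t * b\<^sup>2 * (t * a - 1)\<close>, and this \<open>t\<close> satisfies
    \<open>t * a < 1\<close> whatever the sign of \<open>a\<close>. The lemma is a first-order
    condition; it serves both for Rayleigh quotients and for the risk at
    \<open>\<theta>s\<close>.\<close>
  define t where "t = 1 / (\<bar>a\<bar> + 1)"
  have t: "t > 0" "t * a < 1"
    by (auto simp: t_def field_simps)
  have "0 \<le> (- (b * t)) * b + (- (b * t))\<^sup>2 * a"
    by (rule nonneg)
  also have "\<dots> = t * b\<^sup>2 * (t * a - 1)"
    by (simp add: power2_eq_square algebra_simps)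
  also have "\<dots> < 0"
    using t \<open>b \<noteq> 0\<close> by (intro mult_pos_neg) auto
  finally show False by simp
qed

lemma outer_mult_vec: "outer x *v z = (x \<bullet> z) *\<^sub>R x"
  by (simp add: outer_def matrix_vector_mul_assoc[symmetric])
    (simp add: vec_eq_iff matrix_vector_mult_def columnvector_def rowvector_def inner_vec_def
      sum_distrib_right sum_distrib_left mult_ac)

lemma transpose_outer: "transpose (outer x) = outer x"
  by (simp add: outer_def matrix_transpose_mul transpose_columnvector transpose_rowvector)

lemma symmetric_inner:
  fixes A :: "real ^ 'n ^ 'n"
  assumes "transpose A = A"
  shows "(A *v x) \<bullet> y = x \<bullet> (A *v y)"
  by (metis assms dot_lmul_matrix vector_transpose_matrix)

lemma transpose_add: "transpose (A + B) = transpose A + transpose (B :: real ^ 'n ^ 'm)"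
  by (simp add: transpose_def vec_eq_iff)

lemma pos_def_add_outer:
  assumes "pos_def A"
  shows "pos_def (A + outer x)"
  unfolding pos_def_def
proof (intro conjI allI impI)
  show "transpose (A + outer x) = A + outer x"
    using assms by (simp add: transpose_add transpose_outer pos_def_def)
  fix v :: "real ^ 'a" assume "v \<noteq> 0"
  then have "0 < v \<bullet> (A *v v)" using assms by (simp add: pos_def_def)
  moreover have "0 \<le> v \<bullet> (outer x *v v)"
    by (simp add: outer_mult_vec inner_commute)
  ultimately show "0 < v \<bullet> ((A + outer x) *v v)"
    by (simp add: matrix_vector_mult_add_rdistrib inner_add_right)
qed

lemma pos_def_nonneg: "pos_def A \<Longrightarrow> 0 \<le> v \<bullet> (A *v v)"
  by (cases "v = 0") (auto simp: pos_def_def less_imp_le)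

lemma pos_def_invertible:
  assumes "pos_def A"
  shows "invertible A"
proof -
  have "x = 0" if "A *v x = 0" for x
    using assms that by (force simp: pos_def_def)
  then obtain B where "B ** A = mat 1"
    using matrix_left_invertible_ker[of A] by auto
  then show ?thesis
    using matrix_left_right_inverse unfolding invertible_def by blast
qed

lemma matrix_inv_eqI:
  fixes A :: "real ^ 'n ^ 'n"
  assumes "A ** B = mat 1"
  shows "matrix_inv A = B"
proof -
  have BA: "B ** A = mat 1" using assms by (simp add: matrix_left_right_inverse)
  have "A ** matrix_inv A = mat 1 \<and> matrix_inv A ** A = mat 1"
    unfolding matrix_inv_def by (rule someI[of _ B]) (simp add: assms BA)
  then have "matrix_inv A = (B ** A) ** matrix_inv A"
    using BA by (simp add: matrix_mul_lid)
  also have "\<dots> = B"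
    using \<open>A ** matrix_inv A = mat 1 \<and> _\<close> by (simp add: matrix_mul_assoc[symmetric] matrix_mul_rid)
  finally show ?thesis .
qed

lemma pos_def_matrix_inv:
  assumes "pos_def A"
  shows "A ** matrix_inv A = mat 1" "matrix_inv A ** A = mat 1" "pos_def (matrix_inv A)"
proof -
  obtain B where AB: "A ** B = mat 1" "B ** A = mat 1"
    using pos_def_invertible[OF assms] by (auto simp: invertible_def)
  have inv: "matrix_inv A = B" by (rule matrix_inv_eqI) (rule AB)
  show "A ** matrix_inv A = mat 1" "matrix_inv A ** A = mat 1"
    using AB inv by auto
  have symA: "transpose A = A" using assms by (simp add: pos_def_def)
  have "transpose B ** A = mat 1"
    using AB(1) symA by (metis matrix_transpose_mul transpose_mat)
  then have "transpose B = B"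
    by (metis AB(1) matrix_mul_assoc matrix_mul_lid matrix_mul_rid)
  moreover have "0 < v \<bullet> (B *v v)" if "v \<noteq> 0" for v
  proof -
    have v: "A *v (B *v v) = v"
      by (simp add: matrix_vector_mul_assoc AB)
    then have "B *v v \<noteq> 0" using that by auto
    then have "0 < (B *v v) \<bullet> (A *v (B *v v))"
      using assms by (simp add: pos_def_def)
    then show ?thesis by (simp add: v inner_commute)
  qed
  ultimately show "pos_def (matrix_inv A)"
    by (simp add: inv pos_def_def)
qed

section \<open>Generalized Rayleigh quotients and the largest eigenvalue\<close>

text \<open>The quotient of the two forms is scale invariant, so compactness of the unit sphere of
  \<open>W\<close> yields a maximizer, and its first-order condition is the eigenvalue equation.
  That equation is tested only against vectors of \<open>W\<close>, because competitors have to stay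
  in \<open>W\<close>.\<close>

lemma rayleigh_maximizer:
  fixes A B :: "real ^ 'n ^ 'n"
  assumes A: "pos_def A" and B: "transpose B = B"
    and W: "subspace W" "w0 \<in> W" "w0 \<noteq> 0"
  obtains v \<mu> where "v \<in> W" "v \<bullet> (A *v v) = 1"
    "\<And>h. h \<in> W \<Longrightarrow> h \<bullet> (B *v h) \<le> \<mu> * (h \<bullet> (A *v h))"
    "\<And>h. h \<in> W \<Longrightarrow> h \<bullet> (B *v v) = \<mu> * (h \<bullet> (A *v v))"
proof -
  define q where "q = (\<lambda>h. (h \<bullet> (B *v h)) / (h \<bullet> (A *v h)))"
  let ?S = "W \<inter> sphere 0 1"
  have symA: "transpose A = A" using A by (simp add: pos_def_def)
  have Apos: "0 < h \<bullet> (A *v h)" if "h \<noteq> 0" for h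
    using A that by (simp add: pos_def_def)
  have "compact ?S"
    using W(1) by (intro closed_Int_compact closed_subspace) auto
  moreover have "(1 / norm w0) *\<^sub>R w0 \<in> ?S"
    using W by (simp add: subspace_scale)
  moreover have "continuous_on ?S q"
    unfolding q_def
  proof (intro continuous_intros linear_continuous_on_compose matrix_vector_mul_linear)
    show "\<forall>x\<in>W \<inter> sphere 0 1. x \<bullet> (A *v x) \<noteq> 0"
    proof
      fix x assume "x \<in> W \<inter> sphere 0 1"
      then have "x \<noteq> 0" by auto
      from Apos[OF this] show "x \<bullet> (A *v x) \<noteq> 0" by simp
    qed
  qed
  ultimately obtain u where u: "u \<in> ?S" "\<And>h. h \<in> ?S \<Longrightarrow> q h \<le> q u"
    using continuous_attains_sup[of ?S q] by blast
  define \<mu> where "\<mu> = q u"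
  have le: "h \<bullet> (B *v h) \<le> \<mu> * (h \<bullet> (A *v h))" if h: "h \<in> W" for h
  proof (cases "h = 0")
    case False
    have "(1 / norm h) *\<^sub>R h \<in> ?S" using False h W(1) by (simp add: subspace_scale)
    then have "q ((1 / norm h) *\<^sub>R h) \<le> \<mu>" using u(2) by (simp add: \<mu>_def)
    also have "q ((1 / norm h) *\<^sub>R h) = q h"
      using False by (simp add: q_def matrix_vector_mult_scaleR)
    finally show ?thesis
      using Apos[OF False] by (simp add: q_def pos_divide_le_eq)
  qed simp
  have u0: "u \<noteq> 0" using u(1) by auto
  define c where "c = 1 / sqrt (u \<bullet> (A *v u))"
  define v where "v = c *\<^sub>R u"
  have vW: "v \<in> W" using u(1) W(1) by (simp add: v_def subspace_scale)
  have v1: "v \<bullet> (A *v v) = 1"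
    using Apos[OF u0] by (simp add: v_def c_def matrix_vector_mult_scaleR)
  have "u \<bullet> (B *v u) = \<mu> * (u \<bullet> (A *v u))"
    using Apos[OF u0] by (simp add: \<mu>_def q_def)
  then have vB: "v \<bullet> (B *v v) = \<mu> * (v \<bullet> (A *v v))"
    by (simp add: v_def matrix_vector_mult_scaleR)
  have "h \<bullet> (B *v v) = \<mu> * (h \<bullet> (A *v v))" if h: "h \<in> W" for h
  proof -
    \<comment> \<open>This is \<open>le\<close> at \<open>v + s *\<^sub>R h\<close>: equality at
      \<open>v\<close> removes the constant term, and symmetry merges the cross terms.\<close>
    have "0 \<le> s * (2 * (\<mu> * (h \<bullet> (A *v v)) - h \<bullet> (B *v v)))
        + s\<^sup>2 * (\<mu> * (h \<bullet> (A *v h)) - h \<bullet> (B *v h))" for s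
    proof -
      have sy: "v \<bullet> (A *v h) = h \<bullet> (A *v v)" "v \<bullet> (B *v h) = h \<bullet> (B *v v)"
        using symmetric_inner[OF symA] symmetric_inner[OF B] by (metis inner_commute)+
      have "v + s *\<^sub>R h \<in> W" using h vW W(1) by (simp add: subspace_add subspace_scale)
      from le[OF this] show ?thesis
        by (simp add: matrix_vector_right_distrib matrix_vector_mult_scaleR inner_add_left
            inner_add_right sy vB power2_eq_square algebra_simps)
    qed
    from linear_coeff_zero_if_quadratic_nonneg[OF this] show ?thesis by simp
  qed
  with that[OF vW v1 le] show ?thesis by blast
qed

lemma pos_def_mat1: "pos_def (mat 1)"
  by (simp add: pos_def_def transpose_mat)

text \<open>\<open>lambda_max\<close> is a \<open>GREATEST\<close>, so it has meaning only once a
  largest eigenvalue is exhibited; the maximum of the Rayleigh quotient against the identity is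
  one.\<close>

lemma lambda_max_symmetric:
  fixes A :: "real ^ 'n ^ 'n"
  assumes A: "transpose A = A"
  shows "is_eigenvalue A (lambda_max A)" "h \<bullet> (A *v h) \<le> lambda_max A * (h \<bullet> h)"
proof -
  obtain w0 :: "real ^ 'n" where "w0 \<noteq> 0" using zero_neq_one by metis
  then obtain v \<mu> where v: "v \<bullet> (mat 1 *v v) = 1"
    "\<And>h. h \<bullet> (A *v h) \<le> \<mu> * (h \<bullet> (mat 1 *v h))"
    "\<And>h. h \<bullet> (A *v v) = \<mu> * (h \<bullet> (mat 1 *v v))"
    using rayleigh_maximizer[OF pos_def_mat1 A subspace_UNIV, of w0] by (metis UNIV_I)
  have "A *v v = \<mu> *\<^sub>R v"
    using v(3) by (intro vector_eq_ldot[THEN iffD1]) simp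
  then have eig: "is_eigenvalue A \<mu>"
    using v(1) unfolding is_eigenvalue_def by (intro exI[of _ v]) auto
  have "l \<le> \<mu>" if l: "is_eigenvalue A l" for l
  proof -
    obtain u where u: "u \<noteq> 0" "A *v u = l *\<^sub>R u" using l by (auto simp: is_eigenvalue_def)
    with v(2)[of u] show ?thesis by simp
  qed
  then have "lambda_max A = \<mu>"
    unfolding lambda_max_def using eig by (intro Greatest_equality)
  then show "is_eigenvalue A (lambda_max A)" "h \<bullet> (A *v h) \<le> lambda_max A * (h \<bullet> h)"
    using eig v(2)[of h] by auto
qed

text \<open>Trades eigenvalues for inequalities indexed by vectors, the form in which measurability
  of \<open>lambda_max\<close> becomes accessible.\<close>

lemma lambda_max_le_iff:
  fixes A :: "real ^ 'n ^ 'n"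
  assumes A: "transpose A = A"
  shows "lambda_max A \<le> c \<longleftrightarrow> (\<forall>h. h \<bullet> (A *v h) \<le> c * (h \<bullet> h))"
proof
  assume "lambda_max A \<le> c"
  show "\<forall>h. h \<bullet> (A *v h) \<le> c * (h \<bullet> h)"
  proof
    fix h :: "real ^ 'n"
    have "h \<bullet> (A *v h) \<le> lambda_max A * (h \<bullet> h)" by (rule lambda_max_symmetric(2)[OF A])
    also have "\<dots> \<le> c * (h \<bullet> h)" using \<open>lambda_max A \<le> c\<close> by (intro mult_right_mono) auto
    finally show "h \<bullet> (A *v h) \<le> c * (h \<bullet> h)" .
  qed
next
  assume *: "\<forall>h. h \<bullet> (A *v h) \<le> c * (h \<bullet> h)"
  obtain u where u: "u \<noteq> 0" "A *v u = lambda_max A *\<^sub>R u"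
    using lambda_max_symmetric(1)[OF A] by (auto simp: is_eigenvalue_def)
  with *[rule_format, of u] show "lambda_max A \<le> c" by simp
qed

lemma lambda_max_pos:
  assumes "pos_def A"
  shows "0 < lambda_max A"
proof -
  have A: "transpose A = A" using assms by (simp add: pos_def_def)
  obtain u where u: "u \<noteq> 0" "A *v u = lambda_max A *\<^sub>R u"
    using lambda_max_symmetric(1)[OF A] by (auto simp: is_eigenvalue_def)
  then have "0 < lambda_max A * (u \<bullet> u)" using assms unfolding pos_def_def by fastforce
  moreover have "0 < u \<bullet> u" using u(1) by simp
  ultimately show ?thesis by (simp only: zero_less_mult_pos2)
qed

text \<open>Each new vector maximizes the quotient on the \<open>A\<close>-orthogonal complement of
  the earlier ones, which is nonzero as long as fewer than \<open>CARD('n)\<close> vectors have been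
  chosen. Induction over subsets of \<open>'n\<close> makes the final family indexed by the type
  itself.\<close>

lemma simultaneous_diagonalization:
  fixes A B :: "real ^ 'n ^ 'n"
  assumes A: "pos_def A" and B: "transpose B = B"
  obtains v :: "'n \<Rightarrow> real ^ 'n" and \<mu> :: "'n \<Rightarrow> real" where
    "\<And>i j. v i \<bullet> (A *v v j) = (if i = j then 1 else 0)" "\<And>i. B *v v i = \<mu> i *\<^sub>R (A *v v i)"
proof -
  have symA: "transpose A = A" using A by (simp add: pos_def_def)
  have Asym: "x \<bullet> (A *v y) = y \<bullet> (A *v x)" for x y
    using symmetric_inner[OF symA] by (metis inner_commute)
  have Bsym: "x \<bullet> (B *v y) = y \<bullet> (B *v x)" for x y
    using symmetric_inner[OF B] by (metis inner_commute)
  have "\<exists>(v :: 'n \<Rightarrow> real ^ 'n) \<mu>. \<forall>i\<in>K. (\<forall>j\<in>K. v i \<bullet> (A *v v j) = (if i = j then 1 else 0))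
      \<and> B *v v i = \<mu> i *\<^sub>R (A *v v i)" for K :: "'n set"
    using finite[of K]
  proof (induction K rule: finite_induct)
    case empty
    show ?case by simp
  next
    case (insert k K)
    then obtain v :: "'n \<Rightarrow> real ^ 'n" and \<mu> where
      orth: "\<And>i j. i \<in> K \<Longrightarrow> j \<in> K \<Longrightarrow> v i \<bullet> (A *v v j) = (if i = j then 1 else 0)" and
      eig: "\<And>i. i \<in> K \<Longrightarrow> B *v v i = \<mu> i *\<^sub>R (A *v v i)"
      by blast
    define W where "W = {w. \<forall>i\<in>K. w \<bullet> (A *v v i) = 0}"
    have subW: "subspace W"
      by (auto simp: subspace_def W_def inner_add_left)
    have "dim (span ((\<lambda>i. A *v v i) ` K)) \<le> card ((\<lambda>i. A *v v i) ` K)"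
      using insert(1) by (simp add: dim_le_card')
    also have "\<dots> \<le> card K" using insert(1) by (rule card_image_le)
    also have "\<dots> < CARD('n)"
      using insert(2) by (intro psubset_card_mono) auto
    finally have "dim (span ((\<lambda>i. A *v v i) ` K)) < DIM(real ^ 'n)" by simp
    then obtain w0 where w0: "w0 \<noteq> 0" "\<And>y. y \<in> span (span ((\<lambda>i. A *v v i) ` K)) \<Longrightarrow> orthogonal w0 y"
      using orthogonal_to_subspace_exists by (metis span_span dim_span)
    then have "w0 \<in> W"
      by (auto simp: W_def orthogonal_def intro!: span_base)
    from rayleigh_maximizer[OF A B subW this w0(1)]
    obtain u \<nu> where u: "u \<in> W" "u \<bullet> (A *v u) = 1"
      "\<And>h. h \<in> W \<Longrightarrow> h \<bullet> (B *v u) = \<nu> * (h \<bullet> (A *v u))" by metis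
    have uv: "u \<bullet> (A *v v i) = 0" if "i \<in> K" for i using u(1) that by (auto simp: W_def)
    then have vu: "v i \<bullet> (A *v u) = 0" if "i \<in> K" for i using that Asym by metis
    have "h \<bullet> (B *v u) = h \<bullet> (\<nu> *\<^sub>R (A *v u))" for h
    proof -
      \<comment> \<open>\<open>p\<close> is the \<open>A\<close>-orthogonal projection of
        \<open>h\<close> onto the earlier vectors, so \<open>h - p\<close> lies in \<open>W\<close>,
        where the eigenvalue equation is available. On \<open>p\<close> both sides vanish: by
        orthogonality for \<open>A\<close>, and by symmetry of \<open>B\<close> with the earlier
        eigenvalue equations for \<open>B\<close>.\<close>
      define p where "p = (\<Sum>i\<in>K. (h \<bullet> (A *v v i)) *\<^sub>R v i)"
      have "p \<bullet> (A *v v j) = h \<bullet> (A *v v j)" if "j \<in> K" for j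
      proof -
        have "p \<bullet> (A *v v j) = (\<Sum>i\<in>K. if i = j then h \<bullet> (A *v v j) else 0)"
          unfolding p_def inner_sum_left using orth that by (intro sum.cong) auto
        also have "\<dots> = h \<bullet> (A *v v j)" using that insert(1) by simp
        finally show ?thesis .
      qed
      then have "h - p \<in> W" by (auto simp: W_def inner_diff_left)
      from u(3)[OF this] have "h \<bullet> (B *v u) - p \<bullet> (B *v u) = \<nu> * (h \<bullet> (A *v u) - p \<bullet> (A *v u))"
        by (simp add: inner_diff_left)
      moreover have "p \<bullet> (A *v u) = 0"
        unfolding p_def inner_sum_left using vu by (intro sum.neutral) auto
      moreover have "p \<bullet> (B *v u) = 0"
        unfolding p_def inner_sum_left
      proof (intro sum.neutral ballI)
        fix i assume i: "i \<in> K"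
        have "v i \<bullet> (B *v u) = u \<bullet> (B *v v i)" by (rule Bsym)
        also have "\<dots> = 0" using eig[OF i] uv[OF i] by simp
        finally show "(h \<bullet> (A *v v i)) *\<^sub>R v i \<bullet> (B *v u) = 0" by simp
      qed
      ultimately show ?thesis by simp
    qed
    then have Bu: "B *v u = \<nu> *\<^sub>R (A *v u)" using vector_eq_ldot by blast
    show ?case
    proof (intro exI[of _ "v(k := u)"] exI[of _ "\<mu>(k := \<nu>)"] ballI conjI)
      fix i j assume "i \<in> insert k K" "j \<in> insert k K"
      then show "(v(k := u)) i \<bullet> (A *v (v(k := u)) j) = (if i = j then 1 else 0)"
        using insert(2) orth uv vu u(2) by (cases "i = k"; cases "j = k") auto
    next
      fix i assume "i \<in> insert k K"
      then show "B *v (v(k := u)) i = (\<mu>(k := \<nu>)) i *\<^sub>R (A *v (v(k := u)) i)"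
        using eig Bu by (cases "i = k") auto
    qed
  qed
  from this[of UNIV] that show ?thesis by auto
qed

section \<open>Determinants under rank-one updates\<close>

lemma rank_one_mult_vec:
  fixes u w z :: "real ^ 'n"
  shows "(\<chi> i j. u $ i * w $ j) *v z = (w \<bullet> z) *\<^sub>R u"
  by (simp add: vec_eq_iff matrix_vector_mult_def inner_vec_def sum_distrib_right
      sum_distrib_left mult_ac)

text \<open>A rotation takes \<open>w\<close> to a multiple of a coordinate axis. The rank-one term
  then lives in a single column, so the rotated matrix is the identity with one column replaced by
  \<open>a\<close>, and Cramer's lemma reads off its determinant.\<close>

lemma det_mat1_plus_rank_one:
  fixes u w :: "real ^ 'n"
  shows "det (mat 1 + (\<chi> i j. u $ i * w $ j)) = 1 + u \<bullet> w"
proof -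
  obtain k :: 'n where True by simp
  obtain f where f: "orthogonal_transformation f" "f w = norm w *\<^sub>R axis k (1 :: real)"
    by (rule orthogonal_transformation_exists[of w "norm w *\<^sub>R axis k 1"]) (auto simp: norm_axis_1)
  define T where "T = matrix f"
  have lin: "linear f" using f(1) by (rule orthogonal_transformation_linear)
  have T: "orthogonal_matrix T"
    using f(1) by (simp add: T_def orthogonal_transformation_matrix)
  have Tv: "T *v x = f x" for x by (simp add: T_def matrix_works lin)
  have TT: "T ** transpose T = mat 1" "transpose T ** T = mat 1"
    using T by (auto simp: orthogonal_matrix_def)
  define R where "R = (\<chi> i j. u $ i * w $ j)"
  have Rv: "R *v z = (w \<bullet> z) *\<^sub>R u" for z
    by (simp add: R_def rank_one_mult_vec)
  define a where "a = axis k 1 + norm w *\<^sub>R f u"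
  have fi: "f x \<bullet> f y = x \<bullet> y" for x y
    using f(1) by (simp add: orthogonal_transformation_def)
  have "T ** (mat 1 + R) ** transpose T
      = (\<chi> i j. if j = k then (mat 1 *v a) $ i else mat 1 $ i $ j)" (is "?L = ?C")
  proof -
    have "?L *v z = ?C *v z" for z
    proof -
      have "T *v (transpose T *v z) = z"
        by (simp only: matrix_vector_mul_assoc TT matrix_vector_mul_lid)
      then have z: "f (transpose T *v z) = z"
        by (simp only: Tv)
      have "?L *v z = f (transpose T *v z + (w \<bullet> (transpose T *v z)) *\<^sub>R u)"
        by (simp only: matrix_vector_mul_assoc[symmetric] Tv matrix_vector_mult_add_rdistrib Rv
            matrix_vector_mul_lid)
      also have "\<dots> = z + (w \<bullet> (transpose T *v z)) *\<^sub>R f u"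
        by (simp only: linear_add[OF lin] linear_scale[OF lin] z)
      also have "w \<bullet> (transpose T *v z) = f w \<bullet> z"
        using fi[of w "transpose T *v z"] by (simp only: z)
      also have "\<dots> = norm w * z $ k" by (simp add: f(2) inner_axis' )
      also have "z + (norm w * z $ k) *\<^sub>R f u = ?C *v z"
      proof (simp add: vec_eq_iff, rule allI)
        fix i
        have "(?C *v z) $ i = (\<Sum>j\<in>UNIV. (if j = k then (a $ i - mat 1 $ i $ k) * z $ k else 0)
            + mat 1 $ i $ j * z $ j)"
          by (simp add: matrix_vector_mult_def, intro sum.cong) (auto simp: algebra_simps)
        also have "\<dots> = (a $ i - mat 1 $ i $ k) * z $ k + (mat 1 *v z) $ i"
          by (simp add: sum.distrib matrix_vector_mult_def)
        also have "\<dots> = z $ i + norm w * z $ k * f u $ i"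
          unfolding matrix_vector_mul_lid by (auto simp: a_def axis_def mat_def)
        finally show "z $ i + norm w * z $ k * f u $ i = (?C *v z) $ i" by simp
      qed
      finally show ?thesis .
    qed
    then show ?thesis using matrix_eq by blast
  qed
  then have "det ?L = a $ k * det (mat 1 :: real ^ 'n ^ 'n)"
    using cramer_lemma[of k "mat 1" a] by simp
  moreover have "det ?L = det (mat 1 + R)"
  proof -
    have "det T * det (transpose T) = 1" using TT(1) by (metis det_mul det_I)
    then show ?thesis by (simp add: det_mul algebra_simps)
  qed
  moreover have "a $ k = 1 + u \<bullet> w"
  proof -
    have "u \<bullet> w = f u \<bullet> f w" by (simp add: fi)
    also have "\<dots> = norm w * f u $ k" by (simp add: f(2) inner_axis)
    finally show ?thesis by (simp add: a_def axis_def)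
  qed
  ultimately show ?thesis by (simp add: R_def)
qed

text \<open>Factoring out \<open>S\<close> leaves the identity plus the rank-one matrix with factors
  \<open>P *v x\<close> and \<open>x\<close>, because \<open>S *v (P *v x) = x\<close>.\<close>

lemma det_add_outer:
  fixes S P :: "real ^ 'n ^ 'n"
  assumes "S ** P = mat 1"
  shows "det (S + outer x) = det S * (1 + x \<bullet> (P *v x))"
proof -
  have "S + outer x = S ** (mat 1 + (\<chi> i j. (P *v x) $ i * x $ j))" (is "_ = S ** (mat 1 + ?R)")
  proof -
    have Rv: "?R *v z = (x \<bullet> z) *\<^sub>R (P *v x)" for z
      by (rule rank_one_mult_vec)
    have "(S + outer x) *v z = (S ** (mat 1 + ?R)) *v z" for z
    proof -
      have "(S ** (mat 1 + ?R)) *v z = S *v (z + (x \<bullet> z) *\<^sub>R (P *v x))"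
        by (simp add: matrix_vector_mul_assoc[symmetric] matrix_vector_mult_add_rdistrib Rv)
      also have "\<dots> = S *v z + (x \<bullet> z) *\<^sub>R ((S ** P) *v x)"
        by (simp add: matrix_vector_right_distrib matrix_vector_mult_scaleR matrix_vector_mul_assoc)
      finally show ?thesis
        by (simp add: assms matrix_vector_mult_add_rdistrib outer_mult_vec)
    qed
    then show ?thesis using matrix_eq by blast
  qed
  then show ?thesis
    by (simp add: det_mul det_mat1_plus_rank_one inner_commute)
qed

text \<open>In a basis where \<open>A\<close> becomes the identity and \<open>B\<close> becomes
  diagonal with entries \<open>\<mu> i\<close>, the determinant ratio is the product of these
  entries and the trace is their sum. Carrying the ratio as a factor \<open>c\<close> avoids
  division by \<open>det A\<close>.\<close>

lemma det_ratio_le: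
  fixes A B P :: "real ^ 'n ^ 'n" and x :: "'i \<Rightarrow> real ^ 'n"
  assumes A: "pos_def A" and AP: "A ** P = mat 1" and B: "B = A + (\<Sum>k\<in>K. outer (x k))"
    and posB: "pos_def B" and K: "finite K"
  shows "\<exists>c>0. det B = det A * c \<and> ln c \<le> CARD('n) * ln (1 + (\<Sum>k\<in>K. x k \<bullet> (P *v x k)) / CARD('n))"
proof -
  have symB: "transpose B = B" using posB by (simp add: pos_def_def)
  obtain v :: "'n \<Rightarrow> real ^ 'n" and \<mu> where
    orth: "\<And>i j. v i \<bullet> (A *v v j) = (if i = j then 1 else 0)" and
    eig: "\<And>i. B *v v i = \<mu> i *\<^sub>R (A *v v i)"
    by (rule simultaneous_diagonalization[OF A symB]) blast
  define V where "V = (\<chi> i. v i)"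
  have conj: "(V ** C ** transpose V) $ i $ j = v i \<bullet> (C *v v j)" for C i j
  proof -
    have "(V ** C ** transpose V) $ i $ j = (\<Sum>k\<in>UNIV. \<Sum>l\<in>UNIV. v i $ l * C $ l $ k * v j $ k)"
      by (simp add: matrix_matrix_mult_def transpose_def V_def sum_distrib_right)
    also have "\<dots> = (\<Sum>l\<in>UNIV. \<Sum>k\<in>UNIV. v i $ l * C $ l $ k * v j $ k)" by (rule sum.swap)
    also have "\<dots> = v i \<bullet> (C *v v j)"
      by (simp add: inner_vec_def matrix_vector_mult_def sum_distrib_left mult_ac)
    finally show ?thesis .
  qed
  have VA: "V ** A ** transpose V = mat 1"
    by (simp add: vec_eq_iff conj orth mat_def)
  have "det (V ** B ** transpose V) = (\<Prod>i\<in>UNIV. (V ** B ** transpose V) $ i $ i)"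
    by (rule det_diagonal) (simp add: conj eig orth)
  also have "\<dots> = (\<Prod>i\<in>UNIV. \<mu> i)" by (simp add: conj eig orth)
  finally have dB: "det V * det V * det B = (\<Prod>i\<in>UNIV. \<mu> i)"
    by (simp add: det_mul mult_ac)
  have dA: "det V * det V * det A = 1"
    using arg_cong[OF VA, of det] by (simp add: det_mul mult_ac)
  have \<mu>pos: "0 < \<mu> i" for i
  proof -
    have "v i \<noteq> 0" using orth[of i i] by auto
    then have "0 < v i \<bullet> (B *v v i)" using posB by (simp add: pos_def_def)
    then show ?thesis by (simp add: eig orth)
  qed
  \<comment> \<open>\<open>V ** A ** transpose V = mat 1\<close> forces
    \<open>transpose V ** V = P\<close>, so the quadratic form of \<open>P\<close> is a sum of
    squares over the basis; this is what turns the trace into the quantities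
    \<open>x k \<bullet> (P *v x k)\<close>.\<close>
  have "transpose V ** (V ** A) = mat 1"
    using VA by (simp add: matrix_left_right_inverse)
  then have "transpose V ** V ** (A ** P) = P"
    by (simp only: matrix_mul_assoc matrix_mul_lid)
  then have P: "transpose V ** V = P"
    by (simp only: AP matrix_mul_rid)
  have xPx: "(\<Sum>i\<in>UNIV. (v i \<bullet> z)\<^sup>2) = z \<bullet> (P *v z)" for z
  proof -
    have "z \<bullet> (P *v z) = z \<bullet> (transpose V *v (V *v z))"
      by (simp only: P[symmetric] matrix_vector_mul_assoc)
    also have "\<dots> = (V *v z) \<bullet> (V *v z)"
      by (simp add: dot_lmul_matrix[symmetric] inner_commute)
    also have "\<dots> = (\<Sum>i\<in>UNIV. (v i \<bullet> z)\<^sup>2)"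
      by (simp add: inner_vec_def matrix_vector_mult_def V_def power2_eq_square)
    finally show ?thesis by simp
  qed
  have "\<mu> i = 1 + (\<Sum>k\<in>K. (v i \<bullet> x k)\<^sup>2)" for i
  proof -
    have sum_mv: "(\<Sum>k\<in>K. outer (x k)) *v z = (\<Sum>k\<in>K. outer (x k) *v z)" for z
      using K by (induction K rule: finite_induct) (auto simp: matrix_vector_mult_add_rdistrib)
    have "\<mu> i = v i \<bullet> (B *v v i)" by (simp add: eig orth)
    also have "\<dots> = 1 + (\<Sum>k\<in>K. (v i \<bullet> x k)\<^sup>2)"
      by (simp add: B matrix_vector_mult_add_rdistrib sum_mv inner_add_right orth inner_sum_right
          outer_mult_vec power2_eq_square inner_commute)
    finally show ?thesis .
  qed
  then have "(\<Sum>i\<in>UNIV. \<mu> i) = CARD('n) + (\<Sum>i\<in>UNIV. \<Sum>k\<in>K. (v i \<bullet> x k)\<^sup>2)"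
    by (simp add: sum.distrib)
  also have "(\<Sum>i\<in>UNIV. \<Sum>k\<in>K. (v i \<bullet> x k)\<^sup>2) = (\<Sum>k\<in>K. \<Sum>i\<in>UNIV. (v i \<bullet> x k)\<^sup>2)"
    by (rule sum.swap)
  also have "\<dots> = (\<Sum>k\<in>K. x k \<bullet> (P *v x k))" by (simp add: xPx)
  finally have tr: "(\<Sum>i\<in>UNIV. \<mu> i) = CARD('n) + (\<Sum>k\<in>K. x k \<bullet> (P *v x k))" .
  define m where "m = (\<Sum>i\<in>UNIV. \<mu> i) / CARD('n)"
  have mpos: "m > 0" using \<mu>pos by (simp add: m_def sum_pos)
  have "ln (\<Prod>i\<in>UNIV. \<mu> i) = (\<Sum>i\<in>UNIV. ln (\<mu> i))"
    by (rule ln_prod) (simp_all add: \<mu>pos less_imp_neq[THEN not_sym])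
  \<comment> \<open>Each logarithm lies below its tangent at the mean \<open>m\<close>; the linear
    corrections sum to zero and leave \<open>CARD('n) * ln m\<close>.\<close>
  also have "\<dots> \<le> (\<Sum>i\<in>UNIV. ln m + (\<mu> i / m - 1))"
  proof (rule sum_mono)
    fix i
    have "ln (\<mu> i / m) \<le> \<mu> i / m - 1"
      using \<mu>pos[of i] mpos by (intro ln_le_minus_one) auto
    then show "ln (\<mu> i) \<le> ln m + (\<mu> i / m - 1)"
      using \<mu>pos[of i] mpos by (simp add: ln_div)
  qed
  also have "\<dots> = CARD('n) * ln m + ((\<Sum>i\<in>UNIV. \<mu> i) / m - CARD('n))"
    by (simp add: sum.distrib sum_subtractf sum_divide_distrib)
  also have "(\<Sum>i\<in>UNIV. \<mu> i) / m = CARD('n)"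
    using mpos by (auto simp: m_def)
  also have "m = 1 + (\<Sum>k\<in>K. x k \<bullet> (P *v x k)) / CARD('n)"
    by (simp add: m_def tr add_divide_distrib)
  finally have "ln (\<Prod>i\<in>UNIV. \<mu> i) \<le> CARD('n) * ln (1 + (\<Sum>k\<in>K. x k \<bullet> (P *v x k)) / CARD('n))"
    by simp
  moreover have "det B = det A * (\<Prod>i\<in>UNIV. \<mu> i)"
  proof -
    have "det B = (det V * det V * det A) * det B" by (simp add: dA)
    also have "\<dots> = det A * (\<Prod>i\<in>UNIV. \<mu> i)" by (simp add: dB[symmetric] mult_ac)
    finally show ?thesis .
  qed
  moreover have "0 < (\<Prod>i\<in>UNIV. \<mu> i)" using \<mu>pos by (simp add: prod_pos)
  ultimately show ?thesis by blast
qed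

section \<open>The Kalman recursion\<close>

text \<open>Sherman-Morrison: the update of \<open>P\<close> inverts the addition of
  \<open>outer (x t)\<close> to the information matrix. Positive definiteness belongs to the
  induction because it makes \<open>w\<close> nonnegative and so keeps the denominator
  \<open>1 + w\<close> away from zero.\<close>

lemma static_kalman_inverse:
  assumes kal: "static_kalman P1 \<theta>1 x y P \<theta>" and P1: "pos_def P1" and "1 \<le> t"
  shows "pos_def (matrix_inv P1 + (\<Sum>s = 1..<t. outer (x s))) \<and>
    P t ** (matrix_inv P1 + (\<Sum>s = 1..<t. outer (x s))) = mat 1"
  using \<open>1 \<le> t\<close>
proof (induction t rule: dec_induct)
  case base
  have "P 1 = P1" using kal by (simp add: static_kalman_def)
  with pos_def_matrix_inv[OF P1] show ?case by simp
next
  case (step t)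
  define S where "S = matrix_inv P1 + (\<Sum>s = 1..<t. outer (x s))"
  define w where "w = x t \<bullet> (P t *v x t)"
  have S: "pos_def S" "P t ** S = mat 1" using step.IH by (simp_all add: S_def)
  have SP: "S ** P t = mat 1" using S(2) by (simp add: matrix_left_right_inverse)
  have S': "matrix_inv P1 + (\<Sum>s = 1..<Suc t. outer (x s)) = S + outer (x t)"
    using step.hyps by (simp add: S_def)
  have "P t = matrix_inv S" using matrix_inv_eqI[OF SP] by simp
  then have "pos_def (P t)" using pos_def_matrix_inv(3)[OF S(1)] by simp
  then have w: "0 \<le> w" by (simp add: w_def pos_def_nonneg)
  have P': "P (Suc t) = P t - (1 / (1 + w)) *\<^sub>R (P t ** outer (x t) ** P t)"
    using kal step.hyps by (simp add: static_kalman_def w_def)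
  have scale: "(c *\<^sub>R C) *v z = c *\<^sub>R (C *v z)" for c :: real and C :: "real ^ 'a ^ 'a" and z
    by (simp add: scaleR_matrix_vector_assoc)
  have "(P (Suc t) ** (S + outer (x t))) *v z = mat 1 *v z" for z
  proof -
    have PS: "P t *v (S *v a) = a" for a
      by (simp only: matrix_vector_mul_assoc S(2) matrix_vector_mul_lid)
    have P'v: "P (Suc t) *v a = P t *v a - ((x t \<bullet> (P t *v a)) / (1 + w)) *\<^sub>R (P t *v x t)" for a
      by (simp add: P' matrix_vector_mult_diff_rdistrib scale matrix_vector_mul_assoc[symmetric]
          outer_mult_vec matrix_vector_mult_scaleR)
    define a where "a = S *v z + (x t \<bullet> z) *\<^sub>R x t"
    have Pa: "P t *v a = z + (x t \<bullet> z) *\<^sub>R (P t *v x t)"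
      by (simp add: a_def matrix_vector_right_distrib matrix_vector_mult_scaleR PS)
    have "(P (Suc t) ** (S + outer (x t))) *v z = P (Suc t) *v a"
      by (simp add: a_def matrix_vector_mul_assoc[symmetric] matrix_vector_mult_add_rdistrib outer_mult_vec)
    also have "\<dots> = z + (x t \<bullet> z) *\<^sub>R (P t *v x t)
        - ((x t \<bullet> z + (x t \<bullet> z) * w) / (1 + w)) *\<^sub>R (P t *v x t)"
      unfolding P'v Pa inner_add_right by (simp add: w_def)
    also have "(x t \<bullet> z + (x t \<bullet> z) * w) / (1 + w) = x t \<bullet> z"
      using w by (simp add: divide_simps algebra_simps)
    finally show ?thesis by simp
  qed
  then have "P (Suc t) ** (S + outer (x t)) = mat 1" using matrix_eq by blast
  with pos_def_add_outer[OF S(1)] show ?case unfolding S' by blast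
qed

lemma static_kalman_pos_def:
  assumes kal: "static_kalman P1 \<theta>1 x y P \<theta>" and P1: "pos_def P1" and t: "1 \<le> t"
  shows "pos_def (P t)" "matrix_inv (P t) = matrix_inv P1 + (\<Sum>s = 1..<t. outer (x s))"
proof -
  note inv = static_kalman_inverse[OF assms]
  then show *: "matrix_inv (P t) = matrix_inv P1 + (\<Sum>s = 1..<t. outer (x s))"
    by (intro matrix_inv_eqI) blast
  from inv have "P t = matrix_inv (matrix_inv P1 + (\<Sum>s = 1..<t. outer (x s)))"
    by (metis matrix_inv_eqI matrix_left_right_inverse)
  with inv show "pos_def (P t)" by (metis pos_def_matrix_inv(3))
qed

lemma static_kalman_inv_Suc:
  assumes "static_kalman P1 \<theta>1 x y P \<theta>" and "pos_def P1" and "1 \<le> t"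
  shows "matrix_inv (P (Suc t)) = matrix_inv (P t) + outer (x t)"
  using assms by (simp add: static_kalman_pos_def add.assoc)

text \<open>Rewrites the gain through the matrix before the update. It is thus a function of the
  current state and the new input, and as \<open>w\<close> is nonnegative,
  \<open>w / (1 + w)\<close> lies in \<open>[0, 1)\<close>.\<close>

lemma static_kalman_gain:
  assumes kal: "static_kalman P1 \<theta>1 x y P \<theta>" and P1: "pos_def P1" and t: "1 \<le> t"
  shows "x t \<bullet> (P (Suc t) *v x t) = (x t \<bullet> (P t *v x t)) / (1 + x t \<bullet> (P t *v x t))"
proof -
  define w where "w = x t \<bullet> (P t *v x t)"
  have w: "0 \<le> w" using static_kalman_pos_def(1)[OF assms] by (simp add: w_def pos_def_nonneg)
  have P': "P (Suc t) = P t - (1 / (1 + w)) *\<^sub>R (P t ** outer (x t) ** P t)"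
    using kal t by (simp add: static_kalman_def w_def)
  have "x t \<bullet> (P (Suc t) *v x t) = w - w * w / (1 + w)"
    by (simp add: P' matrix_vector_mult_diff_rdistrib scaleR_matrix_vector_assoc[symmetric]
        matrix_vector_mul_assoc[symmetric] outer_mult_vec matrix_vector_mult_scaleR
        inner_diff_right w_def)
  also have "\<dots> = w / (1 + w)" using w by (simp add: divide_simps algebra_simps)
  finally show ?thesis by (simp add: w_def)
qed

text \<open>Every update subtracts a nonnegative multiple of a square. The comparison lets
  \<open>lambda_max P1\<close> take the place of the data-dependent matrix at later times.\<close>

lemma static_kalman_le_initial:
  assumes kal: "static_kalman P1 \<theta>1 x y P \<theta>" and P1: "pos_def P1" and t: "1 \<le> t"
  shows "z \<bullet> (P t *v z) \<le> z \<bullet> (P1 *v z)"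
  using t
proof (induction t rule: dec_induct)
  case base
  then show ?case using kal by (simp add: static_kalman_def)
next
  case (step t)
  define w where "w = x t \<bullet> (P t *v x t)"
  have pos: "pos_def (P t)" using static_kalman_pos_def(1)[OF kal P1] step.hyps by simp
  then have w: "0 \<le> w" by (simp add: w_def pos_def_nonneg)
  have sym: "z \<bullet> (P t *v x t) = x t \<bullet> (P t *v z)"
    using symmetric_inner[of "P t" z "x t"] pos by (simp add: pos_def_def inner_commute)
  have P': "P (Suc t) = P t - (1 / (1 + w)) *\<^sub>R (P t ** outer (x t) ** P t)"
    using kal step.hyps by (simp add: static_kalman_def w_def)
  have "z \<bullet> (P (Suc t) *v z) = z \<bullet> (P t *v z) - (x t \<bullet> (P t *v z))\<^sup>2 / (1 + w)"
    by (simp add: P' matrix_vector_mult_diff_rdistrib scaleR_matrix_vector_assoc[symmetric]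
        matrix_vector_mul_assoc[symmetric] outer_mult_vec matrix_vector_mult_scaleR
        inner_diff_right sym power2_eq_square)
  also have "\<dots> \<le> z \<bullet> (P t *v z)" using w by simp
  finally show ?case using step.IH by simp
qed

text \<open>Let \<open>S\<close> and \<open>S'\<close> be the inverses of \<open>P\<close> before
  and after the step, and \<open>P'\<close> the updated matrix. As \<open>S' = S + outer x\<close>
  and \<open>S' *v (P' *v x) = x\<close>, the new error \<open>e + r *\<^sub>R (P' *v x)\<close> has
  the old energy plus \<open>u\<^sup>2 + 2 * r * u + r\<^sup>2 * v\<close>; substituting
  \<open>r = \<rho> - u\<close> gives the claim. Being an equality, it telescopes.\<close>

lemma static_kalman_energy:
  fixes \<theta>s :: "real ^ 'd"
  assumes kal: "static_kalman P1 \<theta>1 x y P \<theta>" and P1: "pos_def P1" and t: "1 \<le> t"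
  shows "((\<theta> t - \<theta>s) \<bullet> x t)\<^sup>2 - 2 * (y t - \<theta>s \<bullet> x t) * ((\<theta> t - \<theta>s) \<bullet> x t)
      - (y t - \<theta> t \<bullet> x t)\<^sup>2 * (x t \<bullet> (P (Suc t) *v x t))
    = (\<theta> t - \<theta>s) \<bullet> (matrix_inv (P t) *v (\<theta> t - \<theta>s))
      - (\<theta> (Suc t) - \<theta>s) \<bullet> (matrix_inv (P (Suc t)) *v (\<theta> (Suc t) - \<theta>s))"
proof -
  define e r where "e = \<theta> t - \<theta>s" and "r = y t - \<theta> t \<bullet> x t"
  define S' where "S' = matrix_inv (P (Suc t))"
  have pos: "pos_def (P (Suc t))" using static_kalman_pos_def(1)[OF kal P1] by simp
  then have symS': "transpose S' = S'"
    using pos_def_matrix_inv(3) by (auto simp: S'_def pos_def_def)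
  have S'P: "S' *v (P (Suc t) *v z) = z" for z
    using pos_def_matrix_inv(2)[OF pos] by (simp add: S'_def matrix_vector_mul_assoc)
  have e': "\<theta> (Suc t) - \<theta>s = e + r *\<^sub>R (P (Suc t) *v x t)"
    using kal t by (simp add: static_kalman_def e_def r_def matrix_vector_mult_scaleR)
  have "(e + r *\<^sub>R (P (Suc t) *v x t)) \<bullet> (S' *v (e + r *\<^sub>R (P (Suc t) *v x t)))
      = e \<bullet> (S' *v e) + 2 * r * (e \<bullet> x t) + r\<^sup>2 * (x t \<bullet> (P (Suc t) *v x t))"
  proof -
    have "(P (Suc t) *v x t) \<bullet> (S' *v e) = x t \<bullet> e"
      using symmetric_inner[OF symS', of "P (Suc t) *v x t" e] by (simp add: S'P)
    then show ?thesis
      by (simp add: matrix_vector_right_distrib matrix_vector_mult_scaleR S'P inner_add_left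
          inner_add_right inner_commute power2_eq_square algebra_simps)
  qed
  moreover have "e \<bullet> (S' *v e) = e \<bullet> (matrix_inv (P t) *v e) + (e \<bullet> x t)\<^sup>2"
    using static_kalman_inv_Suc[OF assms(1-3)]
    by (simp add: S'_def matrix_vector_mult_add_rdistrib outer_mult_vec inner_add_right
        inner_commute power2_eq_square)
  moreover have "y t - \<theta>s \<bullet> x t = r + e \<bullet> x t"
    by (simp add: r_def e_def inner_diff_left)
  ultimately show ?thesis
    unfolding e' S'_def[symmetric] e_def[symmetric] r_def[symmetric] by algebra
qed

lemma static_kalman_energy_sum:
  fixes \<theta>s :: "real ^ 'd"
  assumes kal: "static_kalman P1 \<theta>1 x y P \<theta>" and P1: "pos_def P1" and m: "1 \<le> m"
  shows "(\<Sum>t = m..<m + n. ((\<theta> t - \<theta>s) \<bullet> x t)\<^sup>2 - 2 * (y t - \<theta>s \<bullet> x t) * ((\<theta> t - \<theta>s) \<bullet> x t)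
      - (y t - \<theta> t \<bullet> x t)\<^sup>2 * (x t \<bullet> (P (Suc t) *v x t)))
    \<le> lambda_max (matrix_inv (P m)) * (norm (\<theta> m - \<theta>s))\<^sup>2"
proof -
  define E where "E t = (\<theta> t - \<theta>s) \<bullet> (matrix_inv (P t) *v (\<theta> t - \<theta>s))" for t
  have inv: "pos_def (matrix_inv (P t))" if "1 \<le> t" for t
    using static_kalman_pos_def(1)[OF kal P1 that] by (rule pos_def_matrix_inv)
  have "(\<Sum>t = m..<m + n. ((\<theta> t - \<theta>s) \<bullet> x t)\<^sup>2 - 2 * (y t - \<theta>s \<bullet> x t) * ((\<theta> t - \<theta>s) \<bullet> x t)
      - (y t - \<theta> t \<bullet> x t)\<^sup>2 * (x t \<bullet> (P (Suc t) *v x t)))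
    = (\<Sum>t = m..<m + n. E t - E (Suc t))"
    unfolding E_def using m by (intro sum.cong refl static_kalman_energy[OF kal P1]) auto
  also have "\<dots> = - (\<Sum>t = m..<m + n. E (Suc t) - E t)"
    by (simp add: sum_negf[symmetric])
  also have "\<dots> = E m - E (m + n)"
    by (subst sum_Suc_diff') auto
  also have "\<dots> \<le> E m"
    using inv[of "m + n"] m by (simp add: E_def pos_def_nonneg)
  also have "\<dots> \<le> lambda_max (matrix_inv (P m)) * (norm (\<theta> m - \<theta>s))\<^sup>2"
    unfolding E_def power2_norm_eq_inner
    using inv[OF m] by (intro lambda_max_symmetric(2)) (simp add: pos_def_def)
  finally show ?thesis .
qed

text \<open>The determinant of the information matrix grows by the factor \<open>1 + w t\<close> at
  each step, and the gain \<open>w / (1 + w)\<close> is at most \<open>ln (1 + w)\<close>. The gains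
  therefore sum to at most the logarithm of one determinant ratio, taken between times
  \<open>m\<close> and \<open>m + n\<close>.\<close>

lemma static_kalman_gain_sum:
  fixes P1 :: "real ^ 'd ^ 'd"
  assumes kal: "static_kalman P1 \<theta>1 x y P \<theta>" and P1: "pos_def P1" and m: "1 \<le> m"
    and D: "\<And>t. 1 \<le> t \<Longrightarrow> norm (x t) \<le> D"
  shows "(\<Sum>t = m..<m + n. x t \<bullet> (P (Suc t) *v x t))
    \<le> real CARD('d) * ln (1 + real n * (lambda_max P1 * D\<^sup>2 / real CARD('d)))"
proof -
  define S where "S t = matrix_inv (P t)" for t
  define w where "w t = x t \<bullet> (P t *v x t)" for t
  have posP: "pos_def (P t)" if "1 \<le> t" for t using static_kalman_pos_def(1)[OF kal P1 that] .
  have posS: "pos_def (S t)" if "1 \<le> t" for t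
    unfolding S_def using posP[OF that] by (rule pos_def_matrix_inv)
  have SP: "S t ** P t = mat 1" if "1 \<le> t" for t
    unfolding S_def using posP[OF that] by (rule pos_def_matrix_inv)
  have S_Suc: "S (Suc t) = S t + outer (x t)" if "1 \<le> t" for t
    unfolding S_def using that by (rule static_kalman_inv_Suc[OF kal P1])
  have w0: "0 \<le> w t" if "1 \<le> t" for t
    using posP[OF that] by (simp add: w_def pos_def_nonneg)
  have detS: "det (S (m + k)) = det (S m) * exp (\<Sum>t = m..<m + k. ln (1 + w t))" for k
  proof (induction k)
    case (Suc k)
    have "det (S (m + Suc k)) = det (S (m + k)) * (1 + w (m + k))"
      using S_Suc[of "m + k"] det_add_outer[OF SP, of "m + k"] m by (simp add: w_def)
    then show ?case using Suc w0[of "m + k"] m by (simp add: exp_add)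
  qed simp
  have Ssum: "S (m + k) = S m + (\<Sum>t = m..<m + k. outer (x t))" for k
    by (induction k) (use m S_Suc in \<open>auto simp: add.assoc\<close>)
  obtain c where c: "c > 0" "det (S (m + n)) = det (S m) * c"
    "ln c \<le> CARD('d) * ln (1 + (\<Sum>t = m..<m + n. x t \<bullet> (P m *v x t)) / CARD('d))"
    using det_ratio_le[OF posS[OF m] SP[OF m] Ssum[of n]] posS[of "m + n"] m by auto
  have "det (S m) \<noteq> 0"
    using SP[OF m] by (metis det_I det_mul mult_zero_left zero_neq_one)
  then have "c = exp (\<Sum>t = m..<m + n. ln (1 + w t))" using c(2) detS[of n] by simp
  then have lnc: "ln c = (\<Sum>t = m..<m + n. ln (1 + w t))" by simp
  have "(\<Sum>t = m..<m + n. x t \<bullet> (P (Suc t) *v x t)) \<le> (\<Sum>t = m..<m + n. ln (1 + w t))"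
  proof (rule sum_mono)
    fix t assume "t \<in> {m..<m + n}"
    then have t: "1 \<le> t" using m by simp
    have "ln (1 / (1 + w t)) \<le> 1 / (1 + w t) - 1"
      using w0[OF t] by (intro ln_le_minus_one) auto
    then have "w t / (1 + w t) \<le> ln (1 + w t)"
      using w0[OF t] by (simp add: ln_div field_simps)
    then show "x t \<bullet> (P (Suc t) *v x t) \<le> ln (1 + w t)"
      using static_kalman_gain[where x = x, OF kal P1 t] by (simp add: w_def)
  qed
  also have "\<dots> \<le> CARD('d) * ln (1 + (\<Sum>t = m..<m + n. x t \<bullet> (P m *v x t)) / CARD('d))"
    using c(3) lnc by simp
  also have "\<dots> \<le> CARD('d) * ln (1 + real n * (lambda_max P1 * D\<^sup>2) / CARD('d))"
  proof -
    \<comment> \<open>The determinant bound involves \<open>P m\<close>; passing to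
      \<open>P1\<close> makes the right-hand side independent of the observations.\<close>
    have "x t \<bullet> (P m *v x t) \<le> lambda_max P1 * D\<^sup>2" if t: "1 \<le> t" for t
    proof -
      have "x t \<bullet> (P m *v x t) \<le> x t \<bullet> (P1 *v x t)"
        by (rule static_kalman_le_initial[OF kal P1 m])
      also have "\<dots> \<le> lambda_max P1 * (norm (x t))\<^sup>2"
        unfolding power2_norm_eq_inner
        using P1 by (intro lambda_max_symmetric(2)) (simp add: pos_def_def)
      also have "\<dots> \<le> lambda_max P1 * D\<^sup>2"
        using D[OF t] lambda_max_pos[OF P1] by (intro mult_left_mono power_mono) auto
      finally show ?thesis .
    qed
    then have "(\<Sum>t = m..<m + n. x t \<bullet> (P m *v x t)) \<le> (\<Sum>t = m..<m + n. lambda_max P1 * D\<^sup>2)"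
      using m by (intro sum_mono) auto
    moreover have "0 \<le> (\<Sum>t = m..<m + n. x t \<bullet> (P m *v x t))"
      using posP[OF m] by (intro sum_nonneg pos_def_nonneg)
    ultimately show ?thesis
      by (intro mult_left_mono ln_mono add_left_mono divide_right_mono add_pos_nonneg
          divide_nonneg_nonneg) (auto simp: mult_ac)
  qed
  finally show ?thesis by simp
qed

section \<open>Exponential inequalities\<close>

text \<open>Step \<open>k\<close> reads \<open>z (Suc k)\<close>, so the state at \<open>k\<close>
  depends on the inputs \<open>1\<close> to \<open>k\<close> and entry \<open>0\<close> is never
  read. Dependence on the past is thereby expressed through index sets instead of a
  filtration.\<close>

primrec state_seq :: "(nat \<Rightarrow> 's \<Rightarrow> 'z \<Rightarrow> 's) \<Rightarrow> 's \<Rightarrow> (nat \<Rightarrow> 'z) \<Rightarrow> nat \<Rightarrow> 's" where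
  "state_seq F s z 0 = s"
| "state_seq F s z (Suc k) = F k (state_seq F s z k) (z (Suc k))"

lemma measurable_state_seq_PiM:
  assumes F: "\<And>k. case_prod (F k) \<in> S \<Otimes>\<^sub>M N \<rightarrow>\<^sub>M S" and s: "s \<in> space S" and "{1..k} \<subseteq> J"
  shows "(\<lambda>z. state_seq F s z k) \<in> Pi\<^sub>M J (\<lambda>_. N) \<rightarrow>\<^sub>M S"
  using \<open>{1..k} \<subseteq> J\<close>
proof (induction k)
  case 0
  then show ?case using s by simp
next
  case (Suc k)
  have "Suc k \<in> J" and sub: "{1..k} \<subseteq> J" using Suc.prems by auto
  then have "(\<lambda>z. (state_seq F s z k, z (Suc k))) \<in> Pi\<^sub>M J (\<lambda>_. N) \<rightarrow>\<^sub>M S \<Otimes>\<^sub>M N"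
    using Suc.IH[OF sub] by (intro measurable_Pair measurable_component_singleton)
  from measurable_compose[OF this F[of k]] show ?case by simp
qed

lemma state_seq_restrict:
  "{1..k} \<subseteq> J \<Longrightarrow> state_seq F s (restrict z J) k = state_seq F s z k"
  by (induction k) (auto simp: subset_iff)

context prob_space
begin

lemma measurable_state_seq:
  assumes F: "\<And>k. case_prod (F k) \<in> S \<Otimes>\<^sub>M N \<rightarrow>\<^sub>M S" and s: "s \<in> space S"
    and Z: "\<And>k. 1 \<le> k \<Longrightarrow> Z k \<in> M \<rightarrow>\<^sub>M N"
  shows "(\<lambda>\<omega>. state_seq F s (\<lambda>i. Z i \<omega>) k) \<in> M \<rightarrow>\<^sub>M S"
proof (induction k)
  case (Suc k)
  have "(\<lambda>\<omega>. (state_seq F s (\<lambda>i. Z i \<omega>) k, Z (Suc k) \<omega>)) \<in> M \<rightarrow>\<^sub>M S \<Otimes>\<^sub>M N"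
    using Suc Z by (intro measurable_Pair) auto
  from measurable_compose[OF this F[of k]] show ?case by simp
qed (use s in simp)

text \<open>Replaces conditioning on the past. The state is a function of the block
  \<open>{1..k}\<close> and the new input of the block \<open>{Suc k}\<close>; independence makes
  their joint law a product, so the new input is integrated out with the state frozen.\<close>

lemma nn_integral_state_seq_step:
  assumes ind: "indep_vars (\<lambda>_. N) Z {1..}"
    and F: "\<And>k. case_prod (F k) \<in> S \<Otimes>\<^sub>M N \<rightarrow>\<^sub>M S" and s: "s \<in> space S"
    and g: "case_prod g \<in> borel_measurable (S \<Otimes>\<^sub>M N)" and f: "f \<in> borel_measurable S"
    and le: "\<And>x. x \<in> space S \<Longrightarrow> (\<integral>\<^sup>+\<omega>. g x (Z (Suc k) \<omega>) \<partial>M) \<le> f x"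
  shows "(\<integral>\<^sup>+\<omega>. g (state_seq F s (\<lambda>i. Z i \<omega>) k) (Z (Suc k) \<omega>) \<partial>M)
    \<le> (\<integral>\<^sup>+\<omega>. f (state_seq F s (\<lambda>i. Z i \<omega>) k) \<partial>M)"
proof -
  let ?N = "\<lambda>J. Pi\<^sub>M J (\<lambda>_. N)" and ?R = "\<lambda>J \<omega>. restrict (\<lambda>i. Z i \<omega>) J"
  let ?h = "\<lambda>z. state_seq F s z k"
  have rv: "?R {1..k} \<in> M \<rightarrow>\<^sub>M ?N {1..k}" "?R {Suc k} \<in> M \<rightarrow>\<^sub>M ?N {Suc k}"
    and dist: "distr M (?N {1..k}) (?R {1..k}) \<Otimes>\<^sub>M distr M (?N {Suc k}) (?R {Suc k})
      = distr M (?N {1..k} \<Otimes>\<^sub>M ?N {Suc k}) (\<lambda>\<omega>. (?R {1..k} \<omega>, ?R {Suc k} \<omega>))"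
    using indep_var_restrict[OF ind, of "{1..k}" "{Suc k}"] unfolding indep_var_distribution_eq by auto
  interpret R: prob_space "distr M (?N {Suc k}) (?R {Suc k})" using rv(2) by (rule prob_space_distr)
  have h: "?h \<in> ?N {1..k} \<rightarrow>\<^sub>M S" by (rule measurable_state_seq_PiM[OF F s]) simp
  have "(\<lambda>p. (?h (fst p), snd p (Suc k))) \<in> ?N {1..k} \<Otimes>\<^sub>M ?N {Suc k} \<rightarrow>\<^sub>M S \<Otimes>\<^sub>M N"
    by (intro measurable_Pair measurable_compose[OF measurable_fst h]
        measurable_compose[OF measurable_snd measurable_component_singleton]) simp
  from measurable_compose[OF this g]
  have G: "(\<lambda>(r, r'). g (?h r) (r' (Suc k))) \<in> borel_measurable (?N {1..k} \<Otimes>\<^sub>M ?N {Suc k})"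
    by (simp add: case_prod_beta')
  then have G': "(\<lambda>(r, r'). g (?h r) (r' (Suc k))) \<in> borel_measurable
      (distr M (?N {1..k}) (?R {1..k}) \<Otimes>\<^sub>M distr M (?N {Suc k}) (?R {Suc k}))"
    by (simp cong: measurable_cong_sets)
  have "(\<integral>\<^sup>+\<omega>. g (state_seq F s (\<lambda>i. Z i \<omega>) k) (Z (Suc k) \<omega>) \<partial>M)
      = (\<integral>\<^sup>+p. (case p of (r, r') \<Rightarrow> g (?h r) (r' (Suc k)))
          \<partial>distr M (?N {1..k} \<Otimes>\<^sub>M ?N {Suc k}) (\<lambda>\<omega>. (?R {1..k} \<omega>, ?R {Suc k} \<omega>)))"
    using rv G by (subst nn_integral_distr) (auto simp: state_seq_restrict)
  also have "\<dots> = (\<integral>\<^sup>+r. \<integral>\<^sup>+r'. g (?h r) (r' (Suc k)) \<partial>distr M (?N {Suc k}) (?R {Suc k})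
      \<partial>distr M (?N {1..k}) (?R {1..k}))"
    unfolding dist[symmetric] using R.nn_integral_fst[OF G'] by simp
  also have "\<dots> \<le> (\<integral>\<^sup>+r. f (?h r) \<partial>distr M (?N {1..k}) (?R {1..k}))"
  proof (rule nn_integral_mono)
    fix r assume "r \<in> space (distr M (?N {1..k}) (?R {1..k}))"
    then have r: "r \<in> space (?N {1..k})" by simp
    have "(\<lambda>r'. g (?h r) (r' (Suc k))) \<in> borel_measurable (?N {Suc k})"
      using measurable_compose_Pair1[OF r G] by simp
    then have "(\<integral>\<^sup>+r'. g (?h r) (r' (Suc k)) \<partial>distr M (?N {Suc k}) (?R {Suc k}))
        = (\<integral>\<^sup>+\<omega>. g (?h r) (Z (Suc k) \<omega>) \<partial>M)"
      using rv(2) by (subst nn_integral_distr) auto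
    with le[OF measurable_space[OF h r]]
    show "(\<integral>\<^sup>+r'. g (?h r) (r' (Suc k)) \<partial>distr M (?N {Suc k}) (?R {Suc k})) \<le> f (?h r)" by simp
  qed
  also have "\<dots> = (\<integral>\<^sup>+\<omega>. f (state_seq F s (\<lambda>i. Z i \<omega>) k) \<partial>M)"
    using rv(1) measurable_compose[OF h f] by (subst nn_integral_distr) (auto simp: state_seq_restrict)
  finally show ?thesis .
qed

text \<open>Ville's inequality; the process is stopped at the first passage above \<open>c\<close>, which makes
  the passage events increasing.\<close>

lemma state_seq_exp_maximal:
  fixes w :: "nat \<Rightarrow> 's \<Rightarrow> 'z \<Rightarrow> real" and c :: real
  assumes ind: "indep_vars (\<lambda>_. N) Z {1..}"
    and F: "\<And>k. case_prod (F k) \<in> S \<Otimes>\<^sub>M N \<rightarrow>\<^sub>M S" and s: "s \<in> space S"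
    and w[measurable]: "\<And>k. case_prod (w k) \<in> borel_measurable (S \<Otimes>\<^sub>M N)"
    and le: "\<And>k x. x \<in> space S \<Longrightarrow> (\<integral>\<^sup>+\<omega>. ennreal (exp (w k x (Z (Suc k) \<omega>))) \<partial>M) \<le> 1"
  shows "\<exists>A\<in>sets M. emeasure M A \<le> ennreal (exp (- c)) \<and>
    {\<omega> \<in> space M. \<exists>n. c \<le> (\<Sum>k<n. w k (state_seq F s (\<lambda>i. Z i \<omega>) k) (Z (Suc k) \<omega>))} \<subseteq> A"
proof -
  have Z[measurable]: "Z k \<in> M \<rightarrow>\<^sub>M N" if "1 \<le> k" for k
    using ind that by (auto simp: indep_vars_def)
  \<comment> \<open>The partial sum joins the state and freezes once it has reached
    \<open>c\<close>. The stopped process is then again a \<open>state_seq\<close>, to which the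
    one-step inequality applies.\<close>
  define F' where "F' = (\<lambda>k (x, a) z. (F k x z, if c \<le> a then a else a + w k x z))"
  have F'[measurable]: "case_prod (F' k) \<in> (S \<Otimes>\<^sub>M borel) \<Otimes>\<^sub>M N \<rightarrow>\<^sub>M S \<Otimes>\<^sub>M borel" for k
  proof -
    have *: "(\<lambda>p. (fst (fst p), snd p)) \<in> (S \<Otimes>\<^sub>M (borel :: real measure)) \<Otimes>\<^sub>M N \<rightarrow>\<^sub>M S \<Otimes>\<^sub>M N"
      by measurable
    have [measurable]: "(\<lambda>p. F k (fst (fst p)) (snd p)) \<in> (S \<Otimes>\<^sub>M (borel :: real measure)) \<Otimes>\<^sub>M N \<rightarrow>\<^sub>M S"
      using measurable_compose[OF * F[of k]] by simp
    have [measurable]: "(\<lambda>p. w k (fst (fst p)) (snd p)) \<in> (S \<Otimes>\<^sub>M (borel :: real measure)) \<Otimes>\<^sub>M N \<rightarrow>\<^sub>M borel"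
      using measurable_compose[OF * w[of k]] by simp
    show ?thesis
      unfolding F'_def case_prod_beta by measurable
  qed
  have s': "(s, 0 :: real) \<in> space (S \<Otimes>\<^sub>M borel)" using s by (simp add: space_pair_measure)
  define T where "T \<omega> k = state_seq F' (s, 0) (\<lambda>i. Z i \<omega>) k" for \<omega> k
  have T[measurable]: "(\<lambda>\<omega>. T \<omega> k) \<in> M \<rightarrow>\<^sub>M S \<Otimes>\<^sub>M borel" for k
    unfolding T_def by (rule measurable_state_seq[OF F' s' Z])
  have T_Suc: "T \<omega> (Suc k) = F' k (T \<omega> k) (Z (Suc k) \<omega>)" for \<omega> k
    by (simp add: T_def)
  have fst_T: "fst (T \<omega> k) = state_seq F s (\<lambda>i. Z i \<omega>) k" for \<omega> k
    by (induction k) (auto simp: T_def F'_def case_prod_beta)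
  have snd_T_Suc: "snd (T \<omega> (Suc k)) = (if c \<le> snd (T \<omega> k) then snd (T \<omega> k)
      else snd (T \<omega> k) + w k (fst (T \<omega> k)) (Z (Suc k) \<omega>))" for \<omega> k
    by (simp add: T_Suc F'_def case_prod_beta)
  \<comment> \<open>A true partial sum that reaches \<open>c\<close> at time \<open>k\<close> forces
    the stopped one to be at least \<open>c\<close> at that time, by either alternative.\<close>
  have stopped: "c \<le> snd (T \<omega> k) \<or>
      snd (T \<omega> k) = (\<Sum>j<k. w j (state_seq F s (\<lambda>i. Z i \<omega>) j) (Z (Suc j) \<omega>))" for \<omega> k
    by (induction k) (auto simp: snd_T_Suc fst_T, simp add: T_def)
  have exp_le: "(\<integral>\<^sup>+\<omega>. ennreal (exp (snd (T \<omega> k))) \<partial>M) \<le> 1" for k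
  proof (induction k)
    case 0
    show ?case by (simp add: T_def emeasure_space_1)
  next
    case (Suc k)
    define g where "g = (\<lambda>p z. ennreal (exp (snd (F' k p z))))"
    have g: "case_prod g \<in> borel_measurable ((S \<Otimes>\<^sub>M borel) \<Otimes>\<^sub>M N)"
    proof -
      have "(\<lambda>q. ennreal (exp (snd (case_prod (F' k) q)))) \<in> borel_measurable ((S \<Otimes>\<^sub>M borel) \<Otimes>\<^sub>M N)"
        by measurable
      then show ?thesis by (simp add: g_def case_prod_beta')
    qed
    have "(\<integral>\<^sup>+\<omega>. g p (Z (Suc k) \<omega>) \<partial>M) \<le> ennreal (exp (snd p))"
      if p: "p \<in> space (S \<Otimes>\<^sub>M borel)" for p
    proof (cases "c \<le> snd p")
      case True
      then show ?thesis by (simp add: g_def F'_def case_prod_beta emeasure_space_1)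
    next
      case False
      have x: "fst p \<in> space S" using p by (auto simp: space_pair_measure)
      have [measurable]: "(\<lambda>\<omega>. w k (fst p) (Z (Suc k) \<omega>)) \<in> borel_measurable M"
        using measurable_compose[OF Z[of "Suc k"] measurable_compose_Pair1[OF x w[of k]]] by simp
      have "(\<integral>\<^sup>+\<omega>. g p (Z (Suc k) \<omega>) \<partial>M)
          = (\<integral>\<^sup>+\<omega>. ennreal (exp (snd p)) * ennreal (exp (w k (fst p) (Z (Suc k) \<omega>))) \<partial>M)"
        using False by (simp add: g_def F'_def case_prod_beta exp_add ennreal_mult)
      also have "\<dots> = ennreal (exp (snd p)) * (\<integral>\<^sup>+\<omega>. ennreal (exp (w k (fst p) (Z (Suc k) \<omega>))) \<partial>M)"
        by (rule nn_integral_cmult) measurable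
      also have "\<dots> \<le> ennreal (exp (snd p)) * 1"
        using le[OF x] by (rule mult_left_mono) simp
      finally show ?thesis by simp
    qed
    moreover have "(\<lambda>p. ennreal (exp (snd p))) \<in> borel_measurable (S \<Otimes>\<^sub>M borel)" by measurable
    ultimately have "(\<integral>\<^sup>+\<omega>. g (T \<omega> k) (Z (Suc k) \<omega>) \<partial>M) \<le> (\<integral>\<^sup>+\<omega>. ennreal (exp (snd (T \<omega> k))) \<partial>M)"
      unfolding T_def by (intro nn_integral_state_seq_step[OF ind F' s' g])
    then have "(\<integral>\<^sup>+\<omega>. ennreal (exp (snd (T \<omega> (Suc k)))) \<partial>M) \<le> (\<integral>\<^sup>+\<omega>. ennreal (exp (snd (T \<omega> k))) \<partial>M)"
      by (simp only: T_Suc g_def)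
    with Suc show ?case by simp
  qed
  define A where "A k = {\<omega> \<in> space M. c \<le> snd (T \<omega> k)}" for k
  have A[measurable]: "A k \<in> sets M" for k unfolding A_def by measurable
  have "emeasure M (A k) \<le> ennreal (exp (- c))" for k
  proof -
    have "ennreal (exp c) * emeasure M (A k) = (\<integral>\<^sup>+\<omega>. ennreal (exp c) * indicator (A k) \<omega> \<partial>M)"
      by (simp add: nn_integral_cmult_indicator)
    also have "\<dots> \<le> (\<integral>\<^sup>+\<omega>. ennreal (exp (snd (T \<omega> k))) \<partial>M)"
      by (intro nn_integral_mono) (auto simp: A_def indicator_def intro: ennreal_leI)
    also have "\<dots> \<le> 1" by (rule exp_le)
    finally have "ennreal (exp (- c)) * (ennreal (exp c) * emeasure M (A k)) \<le> ennreal (exp (- c)) * 1"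
      by (intro mult_left_mono) auto
    then show ?thesis
      by (simp add: mult.assoc[symmetric] ennreal_mult[symmetric] exp_add[symmetric])
  qed
  moreover have "incseq A"
    by (rule incseq_SucI) (auto simp: A_def snd_T_Suc)
  ultimately have "emeasure M (\<Union>k. A k) \<le> ennreal (exp (- c))"
    by (subst SUP_emeasure_incseq[symmetric]) (auto intro: SUP_least)
  moreover have "{\<omega> \<in> space M. \<exists>n. c \<le> (\<Sum>k<n. w k (state_seq F s (\<lambda>i. Z i \<omega>) k) (Z (Suc k) \<omega>))}
      \<subseteq> (\<Union>k. A k)"
  proof clarsimp
    fix \<omega> n
    assume "\<omega> \<in> space M" "c \<le> (\<Sum>k<n. w k (state_seq F s (\<lambda>i. Z i \<omega>) k) (Z (Suc k) \<omega>))"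
    then have "\<omega> \<in> A n" using stopped[of \<omega> n] by (auto simp: A_def)
    then show "\<exists>k. \<omega> \<in> A k" ..
  qed
  ultimately show ?thesis by (intro bexI[of _ "\<Union>k. A k"]) auto
qed

end

section \<open>Gaussian averaging of sub-Gaussian noise\<close>

text \<open>Completing the square gives a multiple of a normal density with mean
  \<open>\<beta> / q\<close> and standard deviation \<open>1 / sqrt q\<close>, where
  \<open>q = 1 - \<gamma>\<close>. With \<open>\<gamma> = 0\<close> the formula introduces an
  auxiliary Gaussian, and with \<open>\<gamma> = \<sigma>\<^sup>2 * (k \<omega>)\<^sup>2\<close> it
  integrates that Gaussian out again.\<close>

lemma nn_integral_gaussian_exp_quadratic:
  fixes \<alpha> \<beta> \<gamma> :: real
  assumes "\<gamma> < 1"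
  shows "(\<integral>\<^sup>+z. ennreal (std_normal_density z * exp (\<alpha> + \<beta> * z + \<gamma> * z\<^sup>2 / 2)) \<partial>lborel)
    = ennreal (exp (\<alpha> + \<beta>\<^sup>2 / (2 * (1 - \<gamma>))) / sqrt (1 - \<gamma>))"
proof -
  define q where "q = 1 - \<gamma>"
  have q: "q > 0" using assms by (simp add: q_def)
  define C where "C = exp (\<alpha> + \<beta>\<^sup>2 / (2 * q)) / sqrt q"
  have "std_normal_density z * exp (\<alpha> + \<beta> * z + \<gamma> * z\<^sup>2 / 2)
      = C * normal_density (\<beta> / q) (1 / sqrt q) z" for z
  proof -
    have "- z\<^sup>2 / 2 + (\<alpha> + \<beta> * z + \<gamma> * z\<^sup>2 / 2)
        = (\<alpha> + \<beta>\<^sup>2 / (2 * q)) + - (z - \<beta> / q)\<^sup>2 / (2 * (1 / sqrt q)\<^sup>2)"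
    proof -
      have g: "\<gamma> = 1 - q" by (simp add: q_def)
      show ?thesis using q unfolding g
        by (simp add: power_divide power2_diff field_simps power2_eq_square)
    qed
    then have "exp (- z\<^sup>2 / 2) * exp (\<alpha> + \<beta> * z + \<gamma> * z\<^sup>2 / 2)
        = exp (\<alpha> + \<beta>\<^sup>2 / (2 * q)) * exp (- (z - \<beta> / q)\<^sup>2 / (2 * (1 / sqrt q)\<^sup>2))"
      by (simp only: exp_add[symmetric])
    moreover have "1 / sqrt (2 * pi * (1 / sqrt q)\<^sup>2) = sqrt q / sqrt (2 * pi)"
      using q by (simp add: power_divide real_sqrt_divide)
    ultimately show ?thesis
      using q by (simp add: normal_density_def C_def)
  qed
  then have "(\<integral>\<^sup>+z. ennreal (std_normal_density z * exp (\<alpha> + \<beta> * z + \<gamma> * z\<^sup>2 / 2)) \<partial>lborel)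
      = (\<integral>\<^sup>+z. ennreal C * ennreal (normal_density (\<beta> / q) (1 / sqrt q) z) \<partial>lborel)"
    using q by (simp only: C_def ennreal_mult[symmetric] normal_density_nonneg) (simp add: ennreal_mult[symmetric])
  also have "\<dots> = ennreal C * (\<integral>\<^sup>+z. ennreal (normal_density (\<beta> / q) (1 / sqrt q) z) \<partial>lborel)"
    by (rule nn_integral_cmult) simp
  also have "(\<integral>\<^sup>+z. ennreal (normal_density (\<beta> / q) (1 / sqrt q) z) \<partial>lborel) = 1"
    using q by (subst nn_integral_eq_integral) auto
  finally show ?thesis by (simp add: C_def q_def)
qed

text \<open>The exceptional null set in \<open>sub\<close> depends on \<open>s\<close>, so
  \<open>s = g \<omega>\<close> cannot be inserted pointwise. A simple function splits the integral
  into finitely many constant exponents, with the indicators absorbed into the weight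
  \<open>f\<close>; Fatou's lemma then carries the inequality to the limit.\<close>

lemma (in finite_measure_subalgebra) nn_integral_subgaussian_random_exponent:
  fixes \<eta> f g :: "'a \<Rightarrow> real"
  assumes eta[measurable]: "\<eta> \<in> borel_measurable M"
    and sub: "\<And>s. AE \<omega> in M. nn_cond_exp M F (\<lambda>\<omega>. ennreal (exp (s * \<eta> \<omega>))) \<omega> \<le> ennreal (exp (\<sigma>\<^sup>2 * s\<^sup>2 / 2))"
    and f[measurable]: "f \<in> borel_measurable F" and f0: "\<And>\<omega>. 0 \<le> f \<omega>" and g: "g \<in> borel_measurable F"
  shows "(\<integral>\<^sup>+\<omega>. ennreal (f \<omega> * exp (g \<omega> * \<eta> \<omega> - \<sigma>\<^sup>2 * (g \<omega>)\<^sup>2 / 2)) \<partial>M) \<le> (\<integral>\<^sup>+\<omega>. ennreal (f \<omega>) \<partial>M)"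
proof -
  have spF: "space F = space M" using subalg by (simp add: subalgebra_def)
  have FM: "h \<in> borel_measurable M" if "h \<in> borel_measurable F" for h :: "'a \<Rightarrow> real"
    using that by (rule measurable_from_subalg[OF subalg])
  note [measurable] = FM[OF f] FM[OF g]
  have const: "(\<integral>\<^sup>+\<omega>. ennreal (h \<omega> * exp (s * \<eta> \<omega> - \<sigma>\<^sup>2 * s\<^sup>2 / 2)) \<partial>M) \<le> (\<integral>\<^sup>+\<omega>. ennreal (h \<omega>) \<partial>M)"
    if h[measurable]: "h \<in> borel_measurable F" and h0: "\<And>\<omega>. 0 \<le> h \<omega>" for h :: "'a \<Rightarrow> real" and s
  proof -
    define h' where "h' \<omega> = h \<omega> * exp (- (\<sigma>\<^sup>2 * s\<^sup>2 / 2))" for \<omega>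
    have [measurable]: "h' \<in> borel_measurable F" unfolding h'_def by measurable
    have h'0: "0 \<le> h' \<omega>" for \<omega> using h0 by (simp add: h'_def)
    have "(\<integral>\<^sup>+\<omega>. ennreal (h \<omega> * exp (s * \<eta> \<omega> - \<sigma>\<^sup>2 * s\<^sup>2 / 2)) \<partial>M)
        = (\<integral>\<^sup>+\<omega>. ennreal (h' \<omega>) * ennreal (exp (s * \<eta> \<omega>)) \<partial>M)"
    proof (rule nn_integral_cong)
      fix \<omega>
      have "exp (s * \<eta> \<omega> - \<sigma>\<^sup>2 * s\<^sup>2 / 2) = exp (- (\<sigma>\<^sup>2 * s\<^sup>2 / 2)) * exp (s * \<eta> \<omega>)"
        by (simp add: exp_add[symmetric])
      then show "ennreal (h \<omega> * exp (s * \<eta> \<omega> - \<sigma>\<^sup>2 * s\<^sup>2 / 2)) = ennreal (h' \<omega>) * ennreal (exp (s * \<eta> \<omega>))"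
        using h'0 by (simp add: h'_def ennreal_mult[symmetric] mult.assoc)
    qed
    also have "\<dots> = (\<integral>\<^sup>+\<omega>. ennreal (h' \<omega>) * nn_cond_exp M F (\<lambda>\<omega>. ennreal (exp (s * \<eta> \<omega>))) \<omega> \<partial>M)"
      by (rule nn_cond_exp_intg[symmetric]) measurable
    also have "\<dots> \<le> (\<integral>\<^sup>+\<omega>. ennreal (h' \<omega>) * ennreal (exp (\<sigma>\<^sup>2 * s\<^sup>2 / 2)) \<partial>M)"
      using sub[of s] by (intro nn_integral_mono_AE) (auto elim!: eventually_mono intro: mult_left_mono)
    also have "\<dots> = (\<integral>\<^sup>+\<omega>. ennreal (h \<omega>) \<partial>M)"
    proof (rule nn_integral_cong)
      fix \<omega>
      have "h' \<omega> * exp (\<sigma>\<^sup>2 * s\<^sup>2 / 2) = h \<omega>"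
        by (simp add: h'_def mult.assoc exp_add[symmetric])
      then show "ennreal (h' \<omega>) * ennreal (exp (\<sigma>\<^sup>2 * s\<^sup>2 / 2)) = ennreal (h \<omega>)"
        using h'0 by (simp add: ennreal_mult[symmetric])
    qed
    finally show ?thesis .
  qed
  have simple: "(\<integral>\<^sup>+\<omega>. ennreal (f \<omega> * exp (G \<omega> * \<eta> \<omega> - \<sigma>\<^sup>2 * (G \<omega>)\<^sup>2 / 2)) \<partial>M) \<le> (\<integral>\<^sup>+\<omega>. ennreal (f \<omega>) \<partial>M)"
    if G: "simple_function F G" for G
  proof -
    let ?R = "G ` space M"
    have fin: "finite ?R" using G spF by (auto simp: simple_function_def)
    define E where "E s = G -` {s} \<inter> space M" for s
    have E[measurable]: "E s \<in> sets F" for s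
      using G simple_functionD(2)[OF G, of "{s}"] by (simp add: E_def spF)
    then have EM[measurable]: "E s \<in> sets M" for s using subalg by (auto simp: subalgebra_def)
    have split: "ennreal (f \<omega> * k \<omega>) = (\<Sum>s\<in>?R. ennreal (f \<omega> * indicator (E s) \<omega> * k' s \<omega>))"
      if "\<omega> \<in> space M" "k' (G \<omega>) \<omega> = k \<omega>" for \<omega> k k'
    proof -
      have "(\<Sum>s\<in>?R. ennreal (f \<omega> * indicator (E s) \<omega> * k' s \<omega>))
          = (\<Sum>s\<in>?R. if s = G \<omega> then ennreal (f \<omega> * k \<omega>) else 0)"
        using that by (intro sum.cong) (auto simp: E_def indicator_def)
      also have "\<dots> = ennreal (f \<omega> * k \<omega>)" using that fin by simp
      finally show ?thesis by simp
    qed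
    have "(\<integral>\<^sup>+\<omega>. ennreal (f \<omega> * exp (G \<omega> * \<eta> \<omega> - \<sigma>\<^sup>2 * (G \<omega>)\<^sup>2 / 2)) \<partial>M)
        = (\<integral>\<^sup>+\<omega>. (\<Sum>s\<in>?R. ennreal (f \<omega> * indicator (E s) \<omega> * exp (s * \<eta> \<omega> - \<sigma>\<^sup>2 * s\<^sup>2 / 2))) \<partial>M)"
      by (intro nn_integral_cong split) auto
    also have "\<dots> = (\<Sum>s\<in>?R. \<integral>\<^sup>+\<omega>. ennreal (f \<omega> * indicator (E s) \<omega> * exp (s * \<eta> \<omega> - \<sigma>\<^sup>2 * s\<^sup>2 / 2)) \<partial>M)"
      by (rule nn_integral_sum) measurable
    also have "\<dots> \<le> (\<Sum>s\<in>?R. \<integral>\<^sup>+\<omega>. ennreal (f \<omega> * indicator (E s) \<omega>) \<partial>M)"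
      by (intro sum_mono const) (auto simp: f0)
    also have "\<dots> = (\<integral>\<^sup>+\<omega>. (\<Sum>s\<in>?R. ennreal (f \<omega> * indicator (E s) \<omega>)) \<partial>M)"
      by (rule nn_integral_sum[symmetric]) measurable
    also have "\<dots> = (\<integral>\<^sup>+\<omega>. ennreal (f \<omega>) \<partial>M)"
      using split[where k = "\<lambda>_. 1" and k' = "\<lambda>_ _. 1"] by (intro nn_integral_cong) simp
    finally show ?thesis .
  qed
  obtain G where G: "\<And>i. simple_function F (G i)" "\<And>\<omega>. \<omega> \<in> space F \<Longrightarrow> (\<lambda>i. G i \<omega>) \<longlonglongrightarrow> g \<omega>"
    using borel_measurable_implies_sequence_metric[OF g, of 0] by blast
  have [measurable]: "G i \<in> borel_measurable M" for i
    using G(1) by (intro FM borel_measurable_simple_function)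
  define L where "L i \<omega> = ennreal (f \<omega> * exp (G i \<omega> * \<eta> \<omega> - \<sigma>\<^sup>2 * (G i \<omega>)\<^sup>2 / 2))" for i \<omega>
  have [measurable]: "L i \<in> borel_measurable M" for i unfolding L_def by measurable
  have "(\<integral>\<^sup>+\<omega>. ennreal (f \<omega> * exp (g \<omega> * \<eta> \<omega> - \<sigma>\<^sup>2 * (g \<omega>)\<^sup>2 / 2)) \<partial>M) = (\<integral>\<^sup>+\<omega>. liminf (\<lambda>i. L i \<omega>) \<partial>M)"
  proof (rule nn_integral_cong)
    fix \<omega> assume "\<omega> \<in> space M"
    then have "(\<lambda>i. G i \<omega>) \<longlonglongrightarrow> g \<omega>" using G(2) spF by simp
    then have "(\<lambda>i. L i \<omega>) \<longlonglongrightarrow> ennreal (f \<omega> * exp (g \<omega> * \<eta> \<omega> - \<sigma>\<^sup>2 * (g \<omega>)\<^sup>2 / 2))"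
      unfolding L_def by (intro tendsto_ennrealI tendsto_intros) auto
    then show "ennreal (f \<omega> * exp (g \<omega> * \<eta> \<omega> - \<sigma>\<^sup>2 * (g \<omega>)\<^sup>2 / 2)) = liminf (\<lambda>i. L i \<omega>)"
      by (intro lim_imp_Liminf[symmetric]) auto
  qed
  also have "\<dots> \<le> liminf (\<lambda>i. \<integral>\<^sup>+\<omega>. L i \<omega> \<partial>M)"
    by (rule nn_integral_liminf) simp
  also have "\<dots> \<le> liminf (\<lambda>i. \<integral>\<^sup>+\<omega>. ennreal (f \<omega>) \<partial>M)"
    using simple[OF G(1)] by (intro Liminf_mono) (auto simp: L_def)
  also have "\<dots> = (\<integral>\<^sup>+\<omega>. ennreal (f \<omega>) \<partial>M)"
    by (rule lim_imp_Liminf) auto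
  finally show ?thesis .
qed

text \<open>The square in the exponent is linearized by averaging \<open>exp (k z \<eta>)\<close> over a standard Gaussian \<open>z\<close>.\<close>

lemma (in finite_measure_subalgebra) nn_integral_subgaussian_quadratic:
  fixes \<eta> f a k :: "'a \<Rightarrow> real"
  assumes eta[measurable]: "\<eta> \<in> borel_measurable M"
    and sub: "\<And>s. AE \<omega> in M. nn_cond_exp M F (\<lambda>\<omega>. ennreal (exp (s * \<eta> \<omega>))) \<omega> \<le> ennreal (exp (\<sigma>\<^sup>2 * s\<^sup>2 / 2))"
    and f[measurable]: "f \<in> borel_measurable F" and f0: "\<And>\<omega>. 0 \<le> f \<omega>"
    and a[measurable]: "a \<in> borel_measurable F" and k[measurable]: "k \<in> borel_measurable F"
    and k1: "\<And>\<omega>. \<sigma>\<^sup>2 * (k \<omega>)\<^sup>2 < 1"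
  shows "(\<integral>\<^sup>+\<omega>. ennreal (f \<omega> * exp (a \<omega> * \<eta> \<omega> + (k \<omega>)\<^sup>2 * (\<eta> \<omega>)\<^sup>2 / 2)) \<partial>M)
    \<le> (\<integral>\<^sup>+\<omega>. ennreal (f \<omega> * (exp (\<sigma>\<^sup>2 * (a \<omega>)\<^sup>2 / (2 * (1 - \<sigma>\<^sup>2 * (k \<omega>)\<^sup>2))) / sqrt (1 - \<sigma>\<^sup>2 * (k \<omega>)\<^sup>2))) \<partial>M)"
proof -
  have FM: "h \<in> borel_measurable M" if "h \<in> borel_measurable F" for h :: "'a \<Rightarrow> real"
    using that by (rule measurable_from_subalg[OF subalg])
  note [measurable] = FM[OF f] FM[OF a] FM[OF k]
  interpret pair_sigma_finite lborel M ..
  let ?\<phi> = std_normal_density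
  define b where "b \<omega> z = a \<omega> + k \<omega> * z" for \<omega> z
  have "(\<integral>\<^sup>+\<omega>. ennreal (f \<omega> * exp (a \<omega> * \<eta> \<omega> + (k \<omega>)\<^sup>2 * (\<eta> \<omega>)\<^sup>2 / 2)) \<partial>M)
      = (\<integral>\<^sup>+\<omega>. (\<integral>\<^sup>+z. ennreal (f \<omega> * ?\<phi> z * exp (b \<omega> z * \<eta> \<omega>)) \<partial>lborel) \<partial>M)"
  proof (rule nn_integral_cong)
    fix \<omega>
    \<comment> \<open>The Gaussian mean of \<open>exp (k * \<eta> * z)\<close> is exactly the factor
      \<open>exp (k\<^sup>2 * \<eta>\<^sup>2 / 2)\<close> that has to be linearized.\<close>
    have "(\<integral>\<^sup>+z. ennreal (f \<omega> * ?\<phi> z * exp (b \<omega> z * \<eta> \<omega>)) \<partial>lborel)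
        = (\<integral>\<^sup>+z. ennreal (f \<omega>) * ennreal (?\<phi> z * exp (a \<omega> * \<eta> \<omega> + k \<omega> * \<eta> \<omega> * z + 0 * z\<^sup>2 / 2)) \<partial>lborel)"
      by (simp add: b_def f0 ennreal_mult[symmetric] algebra_simps)
    also have "\<dots> = ennreal (f \<omega>) * ennreal (exp (a \<omega> * \<eta> \<omega> + (k \<omega> * \<eta> \<omega>)\<^sup>2 / (2 * (1 - 0))) / sqrt (1 - 0))"
      by (subst nn_integral_cmult) (simp_all only: nn_integral_gaussian_exp_quadratic zero_less_one, simp)
    finally show "ennreal (f \<omega> * exp (a \<omega> * \<eta> \<omega> + (k \<omega>)\<^sup>2 * (\<eta> \<omega>)\<^sup>2 / 2))
        = (\<integral>\<^sup>+z. ennreal (f \<omega> * ?\<phi> z * exp (b \<omega> z * \<eta> \<omega>)) \<partial>lborel)"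
      by (simp add: f0 ennreal_mult[symmetric] power_mult_distrib)
  qed
  also have "\<dots> = (\<integral>\<^sup>+z. (\<integral>\<^sup>+\<omega>. ennreal (f \<omega> * ?\<phi> z * exp (b \<omega> z * \<eta> \<omega>)) \<partial>M) \<partial>lborel)"
    unfolding b_def by (rule Fubini') measurable
  \<comment> \<open>For fixed \<open>z\<close> the exponent \<open>b \<omega> z\<close> is
    \<open>F\<close>-measurable in \<open>\<omega>\<close>, so the bound for random exponents
    applies slice by slice.\<close>
  also have "\<dots> \<le> (\<integral>\<^sup>+z. (\<integral>\<^sup>+\<omega>. ennreal (f \<omega> * ?\<phi> z * exp (\<sigma>\<^sup>2 * (b \<omega> z)\<^sup>2 / 2)) \<partial>M) \<partial>lborel)"
  proof (rule nn_integral_mono)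
    fix z
    have "(\<integral>\<^sup>+\<omega>. ennreal (f \<omega> * ?\<phi> z * exp (b \<omega> z * \<eta> \<omega>)) \<partial>M)
        = (\<integral>\<^sup>+\<omega>. ennreal ((f \<omega> * ?\<phi> z * exp (\<sigma>\<^sup>2 * (b \<omega> z)\<^sup>2 / 2)) * exp (b \<omega> z * \<eta> \<omega> - \<sigma>\<^sup>2 * (b \<omega> z)\<^sup>2 / 2)) \<partial>M)"
      by (simp add: mult.assoc exp_add[symmetric])
    also have "\<dots> \<le> (\<integral>\<^sup>+\<omega>. ennreal (f \<omega> * ?\<phi> z * exp (\<sigma>\<^sup>2 * (b \<omega> z)\<^sup>2 / 2)) \<partial>M)"
      unfolding b_def
      by (rule nn_integral_subgaussian_random_exponent[OF eta sub]) (auto simp: f0)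
    finally show "(\<integral>\<^sup>+\<omega>. ennreal (f \<omega> * ?\<phi> z * exp (b \<omega> z * \<eta> \<omega>)) \<partial>M)
        \<le> (\<integral>\<^sup>+\<omega>. ennreal (f \<omega> * ?\<phi> z * exp (\<sigma>\<^sup>2 * (b \<omega> z)\<^sup>2 / 2)) \<partial>M)" .
  qed
  also have "\<dots> = (\<integral>\<^sup>+\<omega>. (\<integral>\<^sup>+z. ennreal (f \<omega> * ?\<phi> z * exp (\<sigma>\<^sup>2 * (b \<omega> z)\<^sup>2 / 2)) \<partial>lborel) \<partial>M)"
    unfolding b_def by (rule Fubini'[symmetric]) measurable
  also have "\<dots> = (\<integral>\<^sup>+\<omega>. ennreal (f \<omega> * (exp (\<sigma>\<^sup>2 * (a \<omega>)\<^sup>2 / (2 * (1 - \<sigma>\<^sup>2 * (k \<omega>)\<^sup>2)))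
      / sqrt (1 - \<sigma>\<^sup>2 * (k \<omega>)\<^sup>2))) \<partial>M)"
  proof (rule nn_integral_cong)
    fix \<omega>
    define \<gamma> where "\<gamma> = \<sigma>\<^sup>2 * (k \<omega>)\<^sup>2"
    have \<gamma>: "\<gamma> < 1" using k1 by (simp add: \<gamma>_def)
    \<comment> \<open>The remaining Gaussian integral has quadratic coefficient
      \<open>\<gamma>\<close> and converges because \<open>\<gamma> < 1\<close>; the two
      contributions of \<open>a\<close> then combine over \<open>1 - \<gamma>\<close>.\<close>
    have "(\<integral>\<^sup>+z. ennreal (f \<omega> * ?\<phi> z * exp (\<sigma>\<^sup>2 * (b \<omega> z)\<^sup>2 / 2)) \<partial>lborel)
        = (\<integral>\<^sup>+z. ennreal (f \<omega>) * ennreal (?\<phi> z * exp (\<sigma>\<^sup>2 * (a \<omega>)\<^sup>2 / 2 + (\<sigma>\<^sup>2 * a \<omega> * k \<omega>) * z + \<gamma> * z\<^sup>2 / 2)) \<partial>lborel)"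
      by (simp add: b_def \<gamma>_def f0 ennreal_mult[symmetric] algebra_simps power2_eq_square add_divide_distrib)
    also have "\<dots> = ennreal (f \<omega>) * ennreal (exp (\<sigma>\<^sup>2 * (a \<omega>)\<^sup>2 / 2 + (\<sigma>\<^sup>2 * a \<omega> * k \<omega>)\<^sup>2 / (2 * (1 - \<gamma>))) / sqrt (1 - \<gamma>))"
      using \<gamma> by (subst nn_integral_cmult) (simp_all add: nn_integral_gaussian_exp_quadratic)
    also have "\<sigma>\<^sup>2 * (a \<omega>)\<^sup>2 / 2 + (\<sigma>\<^sup>2 * a \<omega> * k \<omega>)\<^sup>2 / (2 * (1 - \<gamma>)) = \<sigma>\<^sup>2 * (a \<omega>)\<^sup>2 / (2 * (1 - \<gamma>))"
    proof -
      have *: "(\<sigma>\<^sup>2 * a \<omega> * k \<omega>)\<^sup>2 = \<sigma>\<^sup>2 * (a \<omega>)\<^sup>2 * \<gamma>"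
        by (simp add: \<gamma>_def power2_eq_square)
      have "d / 2 + d * \<gamma> / (2 * (1 - \<gamma>)) = d / (2 * (1 - \<gamma>))" for d
        using \<gamma> by (simp add: field_simps)
      then show ?thesis unfolding * .
    qed
    finally show "(\<integral>\<^sup>+z. ennreal (f \<omega> * ?\<phi> z * exp (\<sigma>\<^sup>2 * (b \<omega> z)\<^sup>2 / 2)) \<partial>lborel)
        = ennreal (f \<omega> * (exp (\<sigma>\<^sup>2 * (a \<omega>)\<^sup>2 / (2 * (1 - \<sigma>\<^sup>2 * (k \<omega>)\<^sup>2))) / sqrt (1 - \<sigma>\<^sup>2 * (k \<omega>)\<^sup>2)))"
      using \<gamma> by (simp add: \<gamma>_def f0 ennreal_mult[symmetric])
  qed
  finally show ?thesis .
qed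

section \<open>The misspecified linear model\<close>

text \<open>Covers arbitrarily negative \<open>x\<close>, so an upper bound on the exponent is
  enough to apply it. For negative \<open>x\<close>, \<open>(1 - x) * exp x \<le> 1\<close> is
  combined with \<open>1 \<le> 1 - x ^ 3 = (1 - x) * (1 + x + x\<^sup>2)\<close>.\<close>

lemma exp_le_quadratic:
  fixes x :: real
  assumes "x \<le> 1"
  shows "exp x \<le> 1 + x + x\<^sup>2"
proof (cases "0 \<le> x")
  case True
  then show ?thesis using assms by (rule exp_bound)
next
  case False
  have "1 - x \<le> exp (- x)" using exp_ge_add_one_self[of "- x"] by simp
  then have "(1 - x) * exp x \<le> exp (- x) * exp x" by (rule mult_right_mono) simp
  also have "\<dots> = 1" by (simp add: exp_add[symmetric])
  also have "1 \<le> 1 - x ^ 3" using False by (simp add: power_less_zero_eq_numeral less_imp_le)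
  also have "\<dots> = (1 - x) * (1 + x + x\<^sup>2)" by (simp add: algebra_simps power2_eq_square power3_eq_cube)
  finally show ?thesis using False by simp
qed

text \<open>Absorbs the normalization left by the Gaussian integral. It rests on
  \<open>1 \<le> (1 - q) * (1 + 2 * q)\<close>, where \<open>q \<le> 1 / 2\<close> enters.\<close>

lemma inverse_sqrt_le_exp:
  fixes q :: real
  assumes "0 \<le> q" "q \<le> 1 / 2"
  shows "1 / sqrt (1 - q) \<le> exp q"
proof -
  have "1 \<le> (1 - q) * (1 + 2 * q)" using assms by (simp add: algebra_simps mult_left_le)
  also have "\<dots> \<le> (1 - q) * exp (2 * q)" using assms by (intro mult_left_mono) auto
  also have "\<dots> = (1 - q) * (exp q)\<^sup>2" by (simp add: exp_double)
  finally have "sqrt 1 \<le> sqrt ((1 - q) * (exp q)\<^sup>2)" by (simp only: real_sqrt_le_iff)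
  then have "1 \<le> sqrt (1 - q) * exp q" by (simp add: real_sqrt_mult)
  then show ?thesis using assms by (simp add: divide_le_eq mult.commute)
qed

lemma square_le_exp_sum:
  fixes x :: real
  shows "x\<^sup>2 \<le> 2 * (exp x + exp (- x))"
proof -
  have "x\<^sup>2 \<le> 2 * exp \<bar>x\<bar>" using exp_lower_Taylor_quadratic[of "\<bar>x\<bar>"] by simp
  also have "exp \<bar>x\<bar> \<le> exp x + exp (- x)" by (cases "0 \<le> x") auto
  finally show ?thesis by simp
qed

lemma square_add3_le: "(a + b + c)\<^sup>2 \<le> 3 * (a\<^sup>2 + b\<^sup>2 + (c :: real)\<^sup>2)"
proof -
  have "3 * (a\<^sup>2 + b\<^sup>2 + c\<^sup>2) - (a + b + c)\<^sup>2 = (a - b)\<^sup>2 + (b - c)\<^sup>2 + (a - c)\<^sup>2"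
    by (simp add: power2_eq_square algebra_simps)
  moreover have "0 \<le> (a - b)\<^sup>2 + (b - c)\<^sup>2 + (a - c)\<^sup>2" by simp
  ultimately show ?thesis by linarith
qed

section \<open>A single observation of the model\<close>

locale subgaussian_linear_model = prob_space M for M :: "'w measure" +
  fixes X :: "'w \<Rightarrow> real ^ 'd" and y :: "'w \<Rightarrow> real" and \<theta>s :: "real ^ 'd" and DX \<sigma> Dapp :: real
  assumes X[measurable]: "X \<in> borel_measurable M" and y[measurable]: "y \<in> borel_measurable M"
    and X_le: "AE \<omega> in M. norm (X \<omega>) \<le> DX"
    and \<sigma>: "0 < \<sigma>" and subgaussian: "cond_subgaussian M X y \<sigma>"
    and approx: "AE \<omega> in M. \<bar>cond_mean M X y \<omega> - \<theta>s \<bullet> X \<omega>\<bar> \<le> Dapp"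
    and optimal: "risk M X y \<theta>s \<le> risk M X y \<theta>"
begin

text \<open>The residual at \<open>\<theta>s\<close> is split into \<open>noise\<close>, controlled
  only through exponential moments, and \<open>bias\<close>, which is determined by \<open>X\<close>
  and bounded.\<close>

definition noise :: "'w \<Rightarrow> real" where "noise \<omega> = y \<omega> - cond_mean M X y \<omega>"
definition bias :: "'w \<Rightarrow> real" where "bias \<omega> = cond_mean M X y \<omega> - \<theta>s \<bullet> X \<omega>"
definition second_moment :: "real ^ 'd \<Rightarrow> real" where "second_moment e = (\<integral>\<omega>. (e \<bullet> X \<omega>)\<^sup>2 \<partial>M)"

lemma subalgebra_sigma_of: "subalgebra M (sigma_of M X)"
  unfolding subalgebra_def sigma_of_def
  using measurable_sets[OF X] by (auto simp: sets_vimage_algebra2)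

sublocale cond: finite_measure_subalgebra M "sigma_of M X"
  by unfold_locales (rule subalgebra_sigma_of)

lemma X_sigma_of[measurable]: "X \<in> borel_measurable (sigma_of M X)"
  unfolding sigma_of_def by (rule measurable_vimage_algebra1) simp

lemma cond_mean_sigma_of[measurable]: "cond_mean M X y \<in> borel_measurable (sigma_of M X)"
  unfolding cond_mean_def by simp

lemma cond_mean_measurable[measurable]: "cond_mean M X y \<in> borel_measurable M"
  unfolding cond_mean_def by simp

lemma bias_sigma_of[measurable]: "bias \<in> borel_measurable (sigma_of M X)"
  unfolding bias_def[abs_def] by measurable

lemma bias_measurable[measurable]: "bias \<in> borel_measurable M"
  unfolding bias_def[abs_def] by measurable

lemma noise_measurable[measurable]: "noise \<in> borel_measurable M"
  unfolding noise_def[abs_def] by measurable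

lemma bias_le: "AE \<omega> in M. \<bar>bias \<omega>\<bar> \<le> Dapp"
  using approx by (simp add: bias_def)

lemma noise_subgaussian:
  "AE \<omega> in M. nn_cond_exp M (sigma_of M X) (\<lambda>\<omega>. ennreal (exp (s * noise \<omega>))) \<omega> \<le> ennreal (exp (\<sigma>\<^sup>2 * s\<^sup>2 / 2))"
  using subgaussian by (simp add: cond_subgaussian_def noise_def)

lemma residual_eq: "y \<omega> - \<theta>s \<bullet> X \<omega> = noise \<omega> + bias \<omega>"
  by (simp add: noise_def bias_def)

lemma inner_X_le: "AE \<omega> in M. (e \<bullet> X \<omega>)\<^sup>2 \<le> (norm e)\<^sup>2 * DX\<^sup>2"
  using X_le
proof eventually_elim
  fix \<omega> assume "norm (X \<omega>) \<le> DX"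
  then have "\<bar>e \<bullet> X \<omega>\<bar> \<le> norm e * DX"
    using Cauchy_Schwarz_ineq2[of e "X \<omega>"] by (meson mult_left_mono norm_ge_zero order_trans)
  then have "\<bar>e \<bullet> X \<omega>\<bar>\<^sup>2 \<le> (norm e * DX)\<^sup>2" by (intro power_mono) auto
  then show "(e \<bullet> X \<omega>)\<^sup>2 \<le> (norm e)\<^sup>2 * DX\<^sup>2" by (simp add: power_mult_distrib)
qed

lemma integrable_inner_X_square: "integrable M (\<lambda>\<omega>. (e \<bullet> X \<omega>)\<^sup>2)"
  using inner_X_le[of e] by (intro integrable_const_bound[where B = "(norm e)\<^sup>2 * DX\<^sup>2"]) auto

text \<open>The exponential moments at \<open>1\<close> and \<open>-1\<close> are finite and
  together dominate the square. Square integrability of the residual rests on this.\<close>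

lemma integrable_noise_square: "integrable M (\<lambda>\<omega>. (noise \<omega>)\<^sup>2)"
proof -
  have "integrable M (\<lambda>\<omega>. exp (s * noise \<omega>))" for s
  proof -
    have "(\<integral>\<^sup>+\<omega>. ennreal (exp (\<sigma>\<^sup>2 * s\<^sup>2 / 2) * exp (s * noise \<omega> - \<sigma>\<^sup>2 * s\<^sup>2 / 2)) \<partial>M)
        \<le> (\<integral>\<^sup>+\<omega>. ennreal (exp (\<sigma>\<^sup>2 * s\<^sup>2 / 2)) \<partial>M)"
      by (rule cond.nn_integral_subgaussian_random_exponent[OF noise_measurable noise_subgaussian]) auto
    also have "\<dots> < \<infinity>" by (simp add: emeasure_space_1)
    finally have "(\<integral>\<^sup>+\<omega>. ennreal (exp (s * noise \<omega>)) \<partial>M) < \<infinity>"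
      by (simp add: exp_add[symmetric])
    then show ?thesis by (intro integrableI_nonneg) auto
  qed
  from this[of 1] this[of "-1"] have "integrable M (\<lambda>\<omega>. 2 * (exp (noise \<omega>) + exp (- noise \<omega>)))"
    by simp
  then show ?thesis
    by (rule Bochner_Integration.integrable_bound) (use square_le_exp_sum in \<open>auto simp: add_nonneg_nonneg\<close>)
qed

lemma integrable_mult_square:
  assumes [measurable]: "f \<in> borel_measurable M" "g \<in> borel_measurable M"
    and "integrable M (\<lambda>\<omega>. (f \<omega> :: real)\<^sup>2)" "integrable M (\<lambda>\<omega>. (g \<omega> :: real)\<^sup>2)"
  shows "integrable M (\<lambda>\<omega>. f \<omega> * g \<omega>)"
proof (rule Bochner_Integration.integrable_bound)
  show "integrable M (\<lambda>\<omega>. (f \<omega>)\<^sup>2 + (g \<omega>)\<^sup>2)" using assms by simp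
  have "\<bar>a * b\<bar> \<le> a\<^sup>2 + b\<^sup>2" for a b :: real
  proof -
    have "2 * (\<bar>a\<bar> * \<bar>b\<bar>) \<le> a\<^sup>2 + b\<^sup>2"
      using sum_squares_bound[of "\<bar>a\<bar>" "\<bar>b\<bar>"] by (simp add: mult.assoc)
    moreover have "0 \<le> \<bar>a\<bar> * \<bar>b\<bar>" by simp
    ultimately show ?thesis unfolding abs_mult by linarith
  qed
  then show "AE \<omega> in M. norm (f \<omega> * g \<omega>) \<le> norm ((f \<omega>)\<^sup>2 + (g \<omega>)\<^sup>2)"
    by (intro AE_I2) simp
qed measurable

lemma integrable_bias_square: "integrable M (\<lambda>\<omega>. (bias \<omega>)\<^sup>2)"
proof (rule integrable_const_bound[where B = "Dapp\<^sup>2"])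
  show "AE \<omega> in M. norm ((bias \<omega>)\<^sup>2) \<le> Dapp\<^sup>2"
    using bias_le by eventually_elim (simp add: abs_le_square_iff[symmetric])
qed measurable

lemma integrable_residual_square: "integrable M (\<lambda>\<omega>. (y \<omega> - \<theta>s \<bullet> X \<omega>)\<^sup>2)"
proof -
  have "integrable M (\<lambda>\<omega>. (noise \<omega>)\<^sup>2 + 2 * (noise \<omega> * bias \<omega>) + (bias \<omega>)\<^sup>2)"
    by (intro Bochner_Integration.integrable_add integrable_noise_square integrable_bias_square
        integrable_mult_right integrable_mult_square) measurable
  then show ?thesis by (simp add: residual_eq power2_sum algebra_simps)
qed

lemma risk_shift:
  "risk M X y (\<theta>s + e) = risk M X y \<theta>s - (\<integral>\<omega>. (y \<omega> - \<theta>s \<bullet> X \<omega>) * (e \<bullet> X \<omega>) \<partial>M) + second_moment e / 2"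
proof -
  have cross: "integrable M (\<lambda>\<omega>. (y \<omega> - \<theta>s \<bullet> X \<omega>) * (e \<bullet> X \<omega>))"
    by (rule integrable_mult_square[OF _ _ integrable_residual_square integrable_inner_X_square]) measurable
  have "risk M X y (\<theta>s + e)
      = (\<integral>\<omega>. (y \<omega> - \<theta>s \<bullet> X \<omega>)\<^sup>2 / 2 - (y \<omega> - \<theta>s \<bullet> X \<omega>) * (e \<bullet> X \<omega>) + (e \<bullet> X \<omega>)\<^sup>2 / 2 \<partial>M)"
    unfolding risk_def quad_loss_def
    by (intro Bochner_Integration.integral_cong refl)
      (simp add: inner_add_left power2_eq_square field_simps)
  then show ?thesis
    using cross integrable_residual_square integrable_inner_X_square[of e]
    by (simp add: risk_def quad_loss_def second_moment_def)
qed

lemma residual_orthogonal: "(\<integral>\<omega>. (y \<omega> - \<theta>s \<bullet> X \<omega>) * (e \<bullet> X \<omega>) \<partial>M) = 0"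
proof -
  \<comment> \<open>Along the line \<open>\<theta>s + s *\<^sub>R e\<close> the excess risk is a
    quadratic in \<open>s\<close> without constant term, nonnegative by optimality.\<close>
  have "- (\<integral>\<omega>. (y \<omega> - \<theta>s \<bullet> X \<omega>) * (e \<bullet> X \<omega>) \<partial>M) = 0"
  proof (rule linear_coeff_zero_if_quadratic_nonneg)
    fix s :: real
    have "(\<integral>\<omega>. (y \<omega> - \<theta>s \<bullet> X \<omega>) * ((s *\<^sub>R e) \<bullet> X \<omega>) \<partial>M) = s * (\<integral>\<omega>. (y \<omega> - \<theta>s \<bullet> X \<omega>) * (e \<bullet> X \<omega>) \<partial>M)"
      by (subst integral_mult_right_zero[symmetric]) (simp add: mult_ac)
    moreover have "second_moment (s *\<^sub>R e) = s\<^sup>2 * second_moment e"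
      by (simp add: second_moment_def power_mult_distrib)
    ultimately show "0 \<le> s * - (\<integral>\<omega>. (y \<omega> - \<theta>s \<bullet> X \<omega>) * (e \<bullet> X \<omega>) \<partial>M) + s\<^sup>2 * (second_moment e / 2)"
      using optimal[of "\<theta>s + s *\<^sub>R e"] risk_shift[of "s *\<^sub>R e"] by simp
  qed
  then show ?thesis by simp
qed

lemma excess_risk: "risk M X y \<theta> - risk M X y \<theta>s = second_moment (\<theta> - \<theta>s) / 2"
  using risk_shift[of "\<theta> - \<theta>s"] residual_orthogonal[of "\<theta> - \<theta>s"] by simp

text \<open>The bias inherits the orthogonality of the residual: \<open>e \<bullet> X\<close> is
  measurable with respect to \<open>X\<close>, so in its product with \<open>y\<close> the
  conditional mean may replace \<open>y\<close> under the integral.\<close>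

lemma bias_orthogonal: "(\<integral>\<omega>. bias \<omega> * (e \<bullet> X \<omega>) \<partial>M) = 0"
proof -
  have eX: "integrable M (\<lambda>\<omega>. (\<theta>s \<bullet> X \<omega>) * (e \<bullet> X \<omega>))"
    by (rule integrable_mult_square[OF _ _ integrable_inner_X_square integrable_inner_X_square]) measurable
  have res: "integrable M (\<lambda>\<omega>. (y \<omega> - \<theta>s \<bullet> X \<omega>) * (e \<bullet> X \<omega>))"
    by (rule integrable_mult_square[OF _ _ integrable_residual_square integrable_inner_X_square]) measurable
  have ye: "integrable M (\<lambda>\<omega>. (e \<bullet> X \<omega>) * y \<omega>)"
    using Bochner_Integration.integrable_add[OF res eX] by (simp add: algebra_simps)
  have m: "integrable M (\<lambda>\<omega>. (e \<bullet> X \<omega>) * cond_mean M X y \<omega>)"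
    "(\<integral>\<omega>. (e \<bullet> X \<omega>) * cond_mean M X y \<omega> \<partial>M) = (\<integral>\<omega>. (e \<bullet> X \<omega>) * y \<omega> \<partial>M)"
    unfolding cond_mean_def using cond.real_cond_exp_intg[OF ye] by auto
  have "(\<integral>\<omega>. bias \<omega> * (e \<bullet> X \<omega>) \<partial>M)
      = (\<integral>\<omega>. (e \<bullet> X \<omega>) * cond_mean M X y \<omega> - (\<theta>s \<bullet> X \<omega>) * (e \<bullet> X \<omega>) \<partial>M)"
    by (intro Bochner_Integration.integral_cong refl) (simp add: bias_def algebra_simps)
  also have "\<dots> = (\<integral>\<omega>. (e \<bullet> X \<omega>) * y \<omega> \<partial>M) - (\<integral>\<omega>. (\<theta>s \<bullet> X \<omega>) * (e \<bullet> X \<omega>) \<partial>M)"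
    using m eX by simp
  also have "\<dots> = (\<integral>\<omega>. (y \<omega> - \<theta>s \<bullet> X \<omega>) * (e \<bullet> X \<omega>) \<partial>M)"
    using ye eX by (simp add: algebra_simps)
  finally show ?thesis using residual_orthogonal by simp
qed

lemma second_moment_bounds: "0 \<le> second_moment e" "second_moment e \<le> (norm e)\<^sup>2 * DX\<^sup>2"
proof -
  show "0 \<le> second_moment e" by (simp add: second_moment_def)
  have "second_moment e \<le> (\<integral>\<omega>. (norm e)\<^sup>2 * DX\<^sup>2 \<partial>M)"
    unfolding second_moment_def
    using inner_X_le[of e] by (intro integral_mono_AE integrable_inner_X_square) auto
  then show "second_moment e \<le> (norm e)\<^sup>2 * DX\<^sup>2" by (simp add: prob_space)
qed

text \<open>The numerator of the exponent has mean \<open>- 3 * Q\<close> with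
  \<open>Q = second_moment e\<close>, and its square is bounded by terms whose mean is again a
  multiple of \<open>Q\<close>. The drift therefore wins however small \<open>Q\<close> is, once
  \<open>K\<close> is large against \<open>\<epsilon>\<^sup>2 * DX\<^sup>2\<close> and
  \<open>Dapp\<^sup>2\<close>.\<close>

lemma nn_integral_exp_bias_le_1:
  assumes e: "norm e \<le> \<epsilon>" and K: "0 < K" "230 * (Dapp\<^sup>2 + 2 * (\<epsilon>\<^sup>2 * DX\<^sup>2)) \<le> K"
  shows "(\<integral>\<^sup>+\<omega>. ennreal (exp ((second_moment e - 4 * (e \<bullet> X \<omega>)\<^sup>2 + 10 * (bias \<omega> * (e \<bullet> X \<omega>))) / K)) \<partial>M) \<le> 1"
proof -
  define B Q where "B = \<epsilon>\<^sup>2 * DX\<^sup>2" and "Q = second_moment e"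
  define u where "u \<omega> = e \<bullet> X \<omega>" for \<omega>
  define W where "W \<omega> = Q - 4 * (u \<omega>)\<^sup>2 + 10 * (bias \<omega> * u \<omega>)" for \<omega>
  have [measurable]: "u \<in> borel_measurable M" unfolding u_def[abs_def] by measurable
  have eB: "(norm e)\<^sup>2 * DX\<^sup>2 \<le> B" unfolding B_def using e by (intro mult_right_mono power_mono) auto
  have Q: "0 \<le> Q" "Q \<le> B" using second_moment_bounds[of e] eB by (auto simp: Q_def)
  have uB: "AE \<omega> in M. (u \<omega>)\<^sup>2 \<le> B"
    using inner_X_le[of e] by eventually_elim (use eB in \<open>simp add: u_def\<close>)
  have bD: "AE \<omega> in M. (bias \<omega>)\<^sup>2 \<le> Dapp\<^sup>2"
    using bias_le by eventually_elim (simp add: abs_le_square_iff[symmetric])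
  have KB: "230 * Dapp\<^sup>2 + 460 * B \<le> K" using K(2) by (simp add: B_def)
  have B0: "0 \<le> B" using Q by simp
  define R where "R \<omega> = 1 + W \<omega> / K + 3 * (Q * B + (16 * B + 100 * Dapp\<^sup>2) * (u \<omega>)\<^sup>2) / K\<^sup>2" for \<omega>
  have le: "AE \<omega> in M. exp (W \<omega> / K) \<le> R \<omega>"
    using uB bD
  proof eventually_elim
    fix \<omega> assume u: "(u \<omega>)\<^sup>2 \<le> B" and b: "(bias \<omega>)\<^sup>2 \<le> Dapp\<^sup>2"
    have "2 * (bias \<omega> * u \<omega>) \<le> (bias \<omega>)\<^sup>2 + (u \<omega>)\<^sup>2"
      using sum_squares_bound[of "bias \<omega>" "u \<omega>"] by simp
    moreover have "0 \<le> (u \<omega>)\<^sup>2" by simp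
    \<comment> \<open>The quadratic bound on \<open>exp\<close> requires
      \<open>W \<omega> \<le> K\<close>. Here \<open>10 * p\<close> costs at most
      \<open>5 * b + 5 * U\<close>, and \<open>4 * U\<close> of this is cancelled.\<close>
    moreover have "q - 4 * U + 10 * p \<le> B + 5 * (D + B)"
      if "2 * p \<le> b + U" "0 \<le> U" "U \<le> B" "b \<le> D" "q \<le> B" for p q b D U :: real
      using that B0 by argo
    ultimately have "W \<omega> \<le> B + 5 * (Dapp\<^sup>2 + B)" using u b Q(2) unfolding W_def by blast
    also have "\<dots> \<le> K" using KB B0 zero_le_power2[of Dapp] by argo
    finally have "exp (W \<omega> / K) \<le> 1 + W \<omega> / K + (W \<omega> / K)\<^sup>2"
      using K(1) by (intro exp_le_quadratic) simp
    also have "(W \<omega>)\<^sup>2 \<le> 3 * (Q * B + (16 * B + 100 * Dapp\<^sup>2) * (u \<omega>)\<^sup>2)"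
    proof -
      have "(W \<omega>)\<^sup>2 \<le> 3 * Q\<^sup>2 + 3 * (- (4 * (u \<omega>)\<^sup>2))\<^sup>2 + 3 * (10 * (bias \<omega> * u \<omega>))\<^sup>2"
        using square_add3_le[of Q "- (4 * (u \<omega>)\<^sup>2)" "10 * (bias \<omega> * u \<omega>)"]
        by (simp add: W_def distrib_left)
      moreover have "Q\<^sup>2 \<le> Q * B" using Q by (simp add: power2_eq_square mult_left_mono)
      moreover have "(- (4 * (u \<omega>)\<^sup>2))\<^sup>2 = 16 * ((u \<omega>)\<^sup>2 * (u \<omega>)\<^sup>2)"
        by (simp add: power2_eq_square)
      moreover have "(u \<omega>)\<^sup>2 * (u \<omega>)\<^sup>2 \<le> B * (u \<omega>)\<^sup>2" using u by (intro mult_right_mono) auto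
      moreover have "(10 * (bias \<omega> * u \<omega>))\<^sup>2 = 100 * ((bias \<omega>)\<^sup>2 * (u \<omega>)\<^sup>2)"
        by (simp add: power_mult_distrib)
      moreover have "(bias \<omega>)\<^sup>2 * (u \<omega>)\<^sup>2 \<le> Dapp\<^sup>2 * (u \<omega>)\<^sup>2" using b by (intro mult_right_mono) auto
      ultimately have "(W \<omega>)\<^sup>2 \<le> 3 * (Q * B) + 48 * (B * (u \<omega>)\<^sup>2) + 300 * (Dapp\<^sup>2 * (u \<omega>)\<^sup>2)"
        by linarith
      then show ?thesis by (simp add: algebra_simps)
    qed
    then have "(W \<omega> / K)\<^sup>2 \<le> 3 * (Q * B + (16 * B + 100 * Dapp\<^sup>2) * (u \<omega>)\<^sup>2) / K\<^sup>2"
      unfolding power_divide by (rule divide_right_mono) simp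
    finally show "exp (W \<omega> / K) \<le> R \<omega>" by (simp add: R_def)
  qed
  have intu: "integrable M (\<lambda>\<omega>. (u \<omega>)\<^sup>2)" unfolding u_def by (rule integrable_inner_X_square)
  have intbu: "integrable M (\<lambda>\<omega>. bias \<omega> * u \<omega>)"
    by (rule integrable_mult_square[OF _ _ integrable_bias_square intu]) measurable
  have intR: "integrable M R" unfolding R_def[abs_def] W_def[abs_def] using intu intbu by simp
  have Eu: "(\<integral>\<omega>. (u \<omega>)\<^sup>2 \<partial>M) = Q" by (simp add: u_def Q_def second_moment_def)
  have Ebu: "(\<integral>\<omega>. bias \<omega> * u \<omega> \<partial>M) = 0" unfolding u_def by (rule bias_orthogonal)
  have "(\<integral>\<omega>. R \<omega> \<partial>M) = 1 + (Q - 4 * Q) / K + 3 * (Q * B + (16 * B + 100 * Dapp\<^sup>2) * Q) / K\<^sup>2"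
    unfolding R_def W_def using intu intbu by (simp add: Eu Ebu prob_space)
  also have "\<dots> \<le> 1"
  proof -
    \<comment> \<open>The coefficients are \<open>51 = 3 * (1 + 16)\<close> and
      \<open>300 = 3 * 100\<close>. The bracket is at most \<open>3 * K\<close>, so the second-order
      term is at most \<open>3 * Q / K\<close>, which is what the drift provides.\<close>
    have "3 * (Q * B + (16 * B + 100 * Dapp\<^sup>2) * Q) = Q * (51 * B + 300 * Dapp\<^sup>2)"
      by (simp add: algebra_simps)
    also have "\<dots> \<le> Q * (3 * K)"
      using KB B0 Q(1) zero_le_power2[of Dapp] by (intro mult_left_mono) linarith+
    finally have "3 * (Q * B + (16 * B + 100 * Dapp\<^sup>2) * Q) / K\<^sup>2 \<le> Q * (3 * K) / K\<^sup>2"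
      by (rule divide_right_mono) simp
    also have "\<dots> = 3 * Q / K" using K(1) by (simp add: power2_eq_square)
    finally show ?thesis by (simp add: diff_divide_distrib)
  qed
  finally have ER: "(\<integral>\<omega>. R \<omega> \<partial>M) \<le> 1" .
  have R0: "AE \<omega> in M. 0 \<le> R \<omega>" using le by eventually_elim (meson exp_ge_zero order_trans)
  have "(\<integral>\<^sup>+\<omega>. ennreal (exp (W \<omega> / K)) \<partial>M) \<le> (\<integral>\<^sup>+\<omega>. ennreal (R \<omega>) \<partial>M)"
    using le by (intro nn_integral_mono_AE) (auto elim!: eventually_mono intro: ennreal_leI)
  also have "\<dots> = ennreal (\<integral>\<omega>. R \<omega> \<partial>M)" by (rule nn_integral_eq_integral[OF intR R0])
  also have "\<dots> \<le> 1" using ER by simp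
  finally show ?thesis by (simp add: W_def u_def Q_def)
qed

text \<open>Given \<open>X\<close>, only the noise is random. It enters the exponent linearly with
  coefficient \<open>10 * u / K\<close> and quadratically with \<open>15 * v / K\<close>;
  integrating it out costs at most \<open>u\<^sup>2 / K + 120 * \<sigma>\<^sup>2 * v / K\<close>,
  and the previous lemma handles what remains.\<close>

lemma nn_integral_exp_increment_le_1:
  assumes e: "norm e \<le> \<epsilon>" and v[measurable]: "v \<in> borel_measurable (sigma_of M X)"
    and v01: "\<And>\<omega>. 0 \<le> v \<omega>" "\<And>\<omega>. v \<omega> \<le> 1"
    and K: "K = 230 * (4 * \<sigma>\<^sup>2 + Dapp\<^sup>2 + 2 * (\<epsilon>\<^sup>2 * DX\<^sup>2))"
  shows "(\<integral>\<^sup>+\<omega>. ennreal (exp ((second_moment e - 5 * (e \<bullet> X \<omega>)\<^sup>2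
      + 10 * ((y \<omega> - \<theta>s \<bullet> X \<omega>) * (e \<bullet> X \<omega>)) + 5 * (y \<omega> - \<theta>s \<bullet> X \<omega> - e \<bullet> X \<omega>)\<^sup>2 * v \<omega>
      - 15 * (8 * \<sigma>\<^sup>2 + Dapp\<^sup>2 + \<epsilon>\<^sup>2 * DX\<^sup>2) * v \<omega>) / K)) \<partial>M) \<le> 1"
    (is "(\<integral>\<^sup>+\<omega>. ennreal (exp (?E \<omega>)) \<partial>M) \<le> 1")
proof -
  define B Q where "B = \<epsilon>\<^sup>2 * DX\<^sup>2" and "Q = second_moment e"
  define u where "u \<omega> = e \<bullet> X \<omega>" for \<omega>
  define f where "f \<omega> = exp ((Q - 5 * (u \<omega>)\<^sup>2 + 10 * (bias \<omega> * u \<omega>) - 120 * \<sigma>\<^sup>2 * v \<omega>) / K)" for \<omega>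
  define a where "a \<omega> = 10 * u \<omega> / K" for \<omega>
  \<comment> \<open>Chosen so that \<open>(k \<omega>)\<^sup>2 / 2 = 15 * v \<omega> / K\<close>,
    the coefficient of the squared noise.\<close>
  define k where "k \<omega> = sqrt (30 * v \<omega> / K)" for \<omega>
  define q where "q \<omega> = \<sigma>\<^sup>2 * (k \<omega>)\<^sup>2" for \<omega>
  have [measurable]: "u \<in> borel_measurable (sigma_of M X)" unfolding u_def[abs_def] by measurable
  have [measurable]: "f \<in> borel_measurable (sigma_of M X)" "a \<in> borel_measurable (sigma_of M X)"
    "k \<in> borel_measurable (sigma_of M X)"
    unfolding f_def[abs_def] a_def[abs_def] k_def[abs_def] by measurable
  have s2: "0 < \<sigma>\<^sup>2" using \<sigma> by simp
  have B0: "0 \<le> B" by (simp add: B_def)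
  have K': "K = 920 * \<sigma>\<^sup>2 + 230 * Dapp\<^sup>2 + 460 * B" by (simp add: K B_def)
  have K\<sigma>: "920 * \<sigma>\<^sup>2 \<le> K" using B0 zero_le_power2[of Dapp] unfolding K' by linarith
  have K0: "0 < K" using K\<sigma> s2 by linarith
  have k2: "(k \<omega>)\<^sup>2 = 30 * v \<omega> / K" for \<omega> using v01(1)[of \<omega>] K0 by (simp add: k_def)
  have q_eq: "q \<omega> = 30 * \<sigma>\<^sup>2 * v \<omega> / K" for \<omega> by (simp add: q_def k2)
  have q0: "0 \<le> q \<omega>" for \<omega> by (simp add: q_def)
  have q12: "q \<omega> \<le> 1 / 2" for \<omega>
  proof -
    have "30 * \<sigma>\<^sup>2 * v \<omega> \<le> 30 * \<sigma>\<^sup>2 * 1" using v01 by (intro mult_left_mono) auto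
    also have "\<dots> \<le> K / 2" using K\<sigma> s2 by linarith
    finally show ?thesis using K0 by (simp add: q_eq divide_le_eq)
  qed
  have eB: "(norm e)\<^sup>2 * DX\<^sup>2 \<le> B" unfolding B_def using e by (intro mult_right_mono power_mono) auto
  have uB: "AE \<omega> in M. (u \<omega>)\<^sup>2 \<le> B"
    using inner_X_le[of e] by eventually_elim (use eB in \<open>simp add: u_def\<close>)
  have bD: "AE \<omega> in M. (bias \<omega>)\<^sup>2 \<le> Dapp\<^sup>2"
    using bias_le by eventually_elim (simp add: abs_le_square_iff[symmetric])
  have "(\<integral>\<^sup>+\<omega>. ennreal (exp (?E \<omega>)) \<partial>M)
      \<le> (\<integral>\<^sup>+\<omega>. ennreal (f \<omega> * exp (a \<omega> * noise \<omega> + (k \<omega>)\<^sup>2 * (noise \<omega>)\<^sup>2 / 2)) \<partial>M)"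
  proof (rule nn_integral_mono_AE)
    show "AE \<omega> in M. ennreal (exp (?E \<omega>)) \<le> ennreal (f \<omega> * exp (a \<omega> * noise \<omega> + (k \<omega>)\<^sup>2 * (noise \<omega>)\<^sup>2 / 2))"
      using uB bD
    proof eventually_elim
      fix \<omega> assume u: "(u \<omega>)\<^sup>2 \<le> B" and b: "(bias \<omega>)\<^sup>2 \<le> Dapp\<^sup>2"
      define n d where "n = noise \<omega>" and "d = bias \<omega>"
      \<comment> \<open>The term \<open>15 * (Dapp\<^sup>2 + B) * v\<close> arising here is
        cancelled by the last summand of the exponent, which leaves
        \<open>- 120 * \<sigma>\<^sup>2 * v\<close> in reserve for the noise.\<close>
      have "(n + d + - u \<omega>)\<^sup>2 \<le> 3 * (n\<^sup>2 + d\<^sup>2 + (- u \<omega>)\<^sup>2)" by (rule square_add3_le)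
      also have "\<dots> \<le> 3 * (n\<^sup>2 + Dapp\<^sup>2 + B)" using u b by (simp add: d_def)
      finally have "5 * (n + d - u \<omega>)\<^sup>2 * v \<omega> \<le> 5 * (3 * (n\<^sup>2 + Dapp\<^sup>2 + B)) * v \<omega>"
        using v01(1) by (intro mult_right_mono mult_left_mono) auto
      then have "Q - 5 * (u \<omega>)\<^sup>2 + 10 * ((n + d) * u \<omega>) + 5 * (n + d - u \<omega>)\<^sup>2 * v \<omega>
          - 15 * (8 * \<sigma>\<^sup>2 + Dapp\<^sup>2 + B) * v \<omega>
        \<le> (Q - 5 * (u \<omega>)\<^sup>2 + 10 * (d * u \<omega>) - 120 * \<sigma>\<^sup>2 * v \<omega>) + 10 * u \<omega> * n + 15 * v \<omega> * n\<^sup>2"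
        by (simp add: algebra_simps)
      then have "?E \<omega> \<le> ((Q - 5 * (u \<omega>)\<^sup>2 + 10 * (d * u \<omega>) - 120 * \<sigma>\<^sup>2 * v \<omega>) + 10 * u \<omega> * n + 15 * v \<omega> * n\<^sup>2) / K"
        unfolding residual_eq u_def[symmetric] Q_def[symmetric] B_def[symmetric] n_def[symmetric] d_def[symmetric]
        using K0 by (intro divide_right_mono) auto
      also have "\<dots> = (Q - 5 * (u \<omega>)\<^sup>2 + 10 * (d * u \<omega>) - 120 * \<sigma>\<^sup>2 * v \<omega>) / K
          + (a \<omega> * n + (k \<omega>)\<^sup>2 * n\<^sup>2 / 2)"
        by (simp add: a_def k2 add_divide_distrib)
      finally show "ennreal (exp (?E \<omega>)) \<le> ennreal (f \<omega> * exp (a \<omega> * noise \<omega> + (k \<omega>)\<^sup>2 * (noise \<omega>)\<^sup>2 / 2))"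
        unfolding f_def n_def d_def exp_add[symmetric] by (intro ennreal_leI) simp
    qed
  qed
  also have "\<dots> \<le> (\<integral>\<^sup>+\<omega>. ennreal (f \<omega> * (exp (\<sigma>\<^sup>2 * (a \<omega>)\<^sup>2 / (2 * (1 - \<sigma>\<^sup>2 * (k \<omega>)\<^sup>2))) / sqrt (1 - \<sigma>\<^sup>2 * (k \<omega>)\<^sup>2))) \<partial>M)"
  proof (rule cond.nn_integral_subgaussian_quadratic[OF noise_measurable noise_subgaussian])
    show "\<sigma>\<^sup>2 * (k \<omega>)\<^sup>2 < 1" for \<omega> using q12[of \<omega>] by (simp add: q_def)
  qed (auto simp: f_def)
  also have "\<dots> \<le> (\<integral>\<^sup>+\<omega>. ennreal (exp ((Q - 4 * (u \<omega>)\<^sup>2 + 10 * (bias \<omega> * u \<omega>)) / K)) \<partial>M)"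
  proof (intro nn_integral_mono ennreal_leI)
    fix \<omega>
    \<comment> \<open>As \<open>q \<omega> \<le> 1 / 2\<close>, the denominator is at least 1; then
      \<open>100 * \<sigma>\<^sup>2 \<le> K\<close> reduces the cost to a single
      \<open>u\<^sup>2 / K\<close>.\<close>
    have "\<sigma>\<^sup>2 * (a \<omega>)\<^sup>2 / (2 * (1 - q \<omega>)) \<le> \<sigma>\<^sup>2 * (a \<omega>)\<^sup>2 / 1"
      using q12[of \<omega>] by (intro divide_left_mono) auto
    also have "\<dots> = (100 * \<sigma>\<^sup>2 / K) * ((u \<omega>)\<^sup>2 / K)"
      by (simp add: a_def power_divide power_mult_distrib power2_eq_square)
    also have "\<dots> \<le> 1 * ((u \<omega>)\<^sup>2 / K)"
    proof (rule mult_right_mono)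
      have "100 * \<sigma>\<^sup>2 \<le> K" using K\<sigma> s2 by linarith
      then show "100 * \<sigma>\<^sup>2 / K \<le> 1" using K0 by (simp only: divide_le_eq_1_pos)
      show "0 \<le> (u \<omega>)\<^sup>2 / K" using K0 by (intro divide_nonneg_pos) simp_all
    qed
    finally have 1: "\<sigma>\<^sup>2 * (a \<omega>)\<^sup>2 / (2 * (1 - q \<omega>)) \<le> (u \<omega>)\<^sup>2 / K" by simp
    have "1 / sqrt (1 - q \<omega>) \<le> exp (q \<omega>)" by (rule inverse_sqrt_le_exp[OF q0 q12])
    also have "\<dots> \<le> exp (120 * \<sigma>\<^sup>2 * v \<omega> / K)"
      using K0 v01(1)[of \<omega>] by (simp add: q_eq divide_right_mono)
    finally have "f \<omega> * (exp (\<sigma>\<^sup>2 * (a \<omega>)\<^sup>2 / (2 * (1 - q \<omega>))) * (1 / sqrt (1 - q \<omega>)))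
        \<le> f \<omega> * (exp ((u \<omega>)\<^sup>2 / K) * exp (120 * \<sigma>\<^sup>2 * v \<omega> / K))"
      using 1 q12[of \<omega>] by (intro mult_left_mono mult_mono) (auto simp: f_def)
    also have "\<dots> = exp ((Q - 4 * (u \<omega>)\<^sup>2 + 10 * (bias \<omega> * u \<omega>)) / K)"
      by (simp add: f_def exp_add[symmetric] add_divide_distrib[symmetric])
    finally show "f \<omega> * (exp (\<sigma>\<^sup>2 * (a \<omega>)\<^sup>2 / (2 * (1 - \<sigma>\<^sup>2 * (k \<omega>)\<^sup>2))) / sqrt (1 - \<sigma>\<^sup>2 * (k \<omega>)\<^sup>2))
        \<le> exp ((Q - 4 * (u \<omega>)\<^sup>2 + 10 * (bias \<omega> * u \<omega>)) / K)"
      by (simp add: q_def)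
  qed
  also have "\<dots> \<le> 1"
    unfolding Q_def u_def using s2 K0 by (intro nn_integral_exp_bias_le_1[OF e]) (auto simp: K)
  finally show ?thesis .
qed

end

section \<open>The filter as a random process\<close>

lemma borel_measurable_matrix_vector_mult[measurable (raw)]:
  fixes A :: "'a \<Rightarrow> real ^ 'n ^ 'm"
  assumes "A \<in> borel_measurable M" "x \<in> borel_measurable M"
  shows "(\<lambda>\<omega>. A \<omega> *v x \<omega>) \<in> borel_measurable M"
proof -
  have "continuous_on UNIV (\<lambda>p :: (real ^ 'n ^ 'm) \<times> (real ^ 'n). fst p *v snd p)"
    unfolding matrix_vector_mult_def by (intro continuous_intros)
  with assms show ?thesis by (rule borel_measurable_continuous_Pair)
qed

lemma borel_measurable_matrix_matrix_mult[measurable (raw)]: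
  fixes A :: "'a \<Rightarrow> real ^ 'n ^ 'm" and B :: "'a \<Rightarrow> real ^ 'k ^ 'n"
  assumes "A \<in> borel_measurable M" "B \<in> borel_measurable M"
  shows "(\<lambda>\<omega>. A \<omega> ** B \<omega>) \<in> borel_measurable M"
proof -
  have "continuous_on UNIV (\<lambda>p :: (real ^ 'n ^ 'm) \<times> (real ^ 'k ^ 'n). fst p ** snd p)"
    unfolding matrix_matrix_mult_def by (intro continuous_intros)
  with assms show ?thesis by (rule borel_measurable_continuous_Pair)
qed

lemma borel_measurable_outer[measurable (raw)]:
  fixes x :: "'a \<Rightarrow> real ^ 'n"
  assumes "x \<in> borel_measurable M"
  shows "(\<lambda>\<omega>. outer (x \<omega>)) \<in> borel_measurable M"
proof -
  have "continuous_on UNIV (outer :: real ^ 'n \<Rightarrow> _)"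
    unfolding outer_def matrix_matrix_mult_def columnvector_def rowvector_def
    by (intro continuous_intros)
  from borel_measurable_continuous_onI[OF this] assms show ?thesis by (rule measurable_compose[rotated])
qed

text \<open>The Rayleigh inequality is a closed condition on \<open>h\<close>, so a countable dense
  set of vectors decides it and every sublevel set is a countable intersection.\<close>

lemma borel_measurable_lambda_max:
  fixes A :: "'a \<Rightarrow> real ^ 'n ^ 'n"
  assumes A[measurable]: "A \<in> borel_measurable M" and sym: "\<And>\<omega>. \<omega> \<in> space M \<Longrightarrow> transpose (A \<omega>) = A \<omega>"
  shows "(\<lambda>\<omega>. lambda_max (A \<omega>)) \<in> borel_measurable M"
proof (rule borel_measurableI_le)
  fix c :: real
  obtain D :: "(real ^ 'n) set" where D: "countable D"
    "\<And>U. open U \<Longrightarrow> U \<noteq> {} \<Longrightarrow> \<exists>d\<in>D. d \<in> U"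
    by (rule countable_dense_setE) auto
  have "lambda_max (A \<omega>) \<le> c \<longleftrightarrow> (\<forall>h\<in>D. h \<bullet> (A \<omega> *v h) \<le> c * (h \<bullet> h))" if \<omega>: "\<omega> \<in> space M" for \<omega>
  proof -
    let ?U = "{h. c * (h \<bullet> h) < h \<bullet> (A \<omega> *v h)}"
    have "open ?U" by (intro open_Collect_less continuous_intros linear_continuous_on_compose matrix_vector_mul_linear)
    then have "(\<forall>h\<in>D. h \<notin> ?U) \<longleftrightarrow> ?U = {}" using D(2)[of ?U] by blast
    then show ?thesis unfolding lambda_max_le_iff[OF sym[OF \<omega>]] by (force simp: not_less)
  qed
  then have "{\<omega> \<in> space M. lambda_max (A \<omega>) \<le> c} = {\<omega> \<in> space M. \<forall>h\<in>D. h \<bullet> (A \<omega> *v h) \<le> c * (h \<bullet> h)}"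
    by auto
  also have "\<dots> \<in> sets M"
    using D(1) by measurable
  finally show "{\<omega> \<in> space M. lambda_max (A \<omega>) \<le> c} \<in> sets M" .
qed

lemma borel_measurable_fst:
  fixes f :: "'a \<Rightarrow> 'b :: topological_space \<times> 'c :: topological_space"
  assumes "f \<in> borel_measurable M"
  shows "(\<lambda>\<omega>. fst (f \<omega>)) \<in> borel_measurable M"
  by (rule borel_measurable_continuous_on[OF continuous_on_fst[OF continuous_on_id] assms])

definition kalman_step ::
  "(real ^ 'd) \<times> (real ^ 'd ^ 'd) \<Rightarrow> (real ^ 'd) \<times> real \<Rightarrow> (real ^ 'd) \<times> (real ^ 'd ^ 'd)" where
  "kalman_step = (\<lambda>(\<theta>, P) (x, y).
     let P' = P - (1 / (1 + x \<bullet> (P *v x))) *\<^sub>R (P ** outer x ** P)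
     in (\<theta> + P' *v ((y - \<theta> \<bullet> x) *\<^sub>R x), P'))"

lemma measurable_kalman_step:
  "case_prod kalman_step \<in> (borel :: ((real ^ 'd) \<times> (real ^ 'd ^ 'd)) measure) \<Otimes>\<^sub>M borel \<rightarrow>\<^sub>M borel"
proof -
  have "(\<lambda>((\<theta>, P), (x, y)). kalman_step (\<theta>, P) (x, y))
      \<in> borel_measurable ((borel \<Otimes>\<^sub>M borel) \<Otimes>\<^sub>M (borel \<Otimes>\<^sub>M borel) :: (((real ^ 'd) \<times> (real ^ 'd ^ 'd)) \<times> ((real ^ 'd) \<times> real)) measure)"
    unfolding kalman_step_def Let_def case_prod_beta' fst_conv snd_conv by measurable
  then show ?thesis by (simp add: borel_prod case_prod_beta')
qed

text \<open>The filter starts at index 1, so \<open>k\<close> consumed inputs produce the estimate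
  and matrix of index \<open>Suc k\<close>; step \<open>k\<close> then pairs this state with the
  input of the same index.\<close>

lemma state_seq_kalman:
  assumes "static_kalman P1 \<theta>1 x y P \<theta>"
  shows "state_seq (\<lambda>_. kalman_step) (\<theta>1, P1) (\<lambda>t. (x t, y t)) k = (\<theta> (Suc k), P (Suc k))"
  using assms by (induction k) (auto simp: static_kalman_def kalman_step_def Let_def)

context subgaussian_linear_model
begin

lemma second_moment_measurable[measurable]: "second_moment \<in> borel_measurable borel"
  unfolding second_moment_def[abs_def] by measurable

text \<open>Along the filter, \<open>v\<close> is the gain \<open>x \<bullet> (P' *v x)\<close> with the updated matrix \<open>P'\<close>; the absolute
  values only serve to keep \<open>v\<close> in \<open>[0, 1]\<close> for every state, reachable or not.\<close>

definition increment :: "real \<Rightarrow> real \<Rightarrow> (real ^ 'd) \<times> (real ^ 'd ^ 'd) \<Rightarrow> (real ^ 'd) \<times> real \<Rightarrow> real" where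
  "increment \<epsilon> K = (\<lambda>(\<theta>, P) (x, z).
     let e = \<theta> - \<theta>s; v = \<bar>x \<bullet> (P *v x)\<bar> / (1 + \<bar>x \<bullet> (P *v x)\<bar>)
     in if norm e \<le> \<epsilon>
        then (second_moment e - 5 * (e \<bullet> x)\<^sup>2 + 10 * ((z - \<theta>s \<bullet> x) * (e \<bullet> x))
          + 5 * (z - \<theta>s \<bullet> x - e \<bullet> x)\<^sup>2 * v - 15 * (8 * \<sigma>\<^sup>2 + Dapp\<^sup>2 + \<epsilon>\<^sup>2 * DX\<^sup>2) * v) / K
        else 0)"

lemma measurable_increment: "case_prod (increment \<epsilon> K) \<in> borel_measurable (borel \<Otimes>\<^sub>M borel)"
proof -
  have "(\<lambda>((\<theta>, P), (x, z)). increment \<epsilon> K (\<theta>, P) (x, z))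
      \<in> borel_measurable ((borel \<Otimes>\<^sub>M borel) \<Otimes>\<^sub>M (borel \<Otimes>\<^sub>M borel) :: (((real ^ 'd) \<times> (real ^ 'd ^ 'd)) \<times> ((real ^ 'd) \<times> real)) measure)"
    unfolding increment_def Let_def case_prod_beta' fst_conv snd_conv by measurable
  then show ?thesis by (simp add: borel_prod case_prod_beta')
qed

text \<open>Equality of laws reduces a copy to the generic observation \<open>(X, y)\<close>. The
  bound holds from every state \<open>s\<close>: outside the ball the increment is zero and the
  integral is 1.\<close>

lemma nn_integral_exp_increment:
  assumes K: "K = 230 * (4 * \<sigma>\<^sup>2 + Dapp\<^sup>2 + 2 * (\<epsilon>\<^sup>2 * DX\<^sup>2))"
    and Z: "Z \<in> M \<rightarrow>\<^sub>M borel" "distr M borel Z = distr M borel (\<lambda>\<omega>. (X \<omega>, y \<omega>))"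
  shows "(\<integral>\<^sup>+\<omega>. ennreal (exp (increment \<epsilon> K s (Z \<omega>))) \<partial>M) \<le> 1"
proof -
  obtain \<theta> P where s: "s = (\<theta>, P)" by (cases s)
  have m: "increment \<epsilon> K s \<in> borel_measurable borel"
    using measurable_compose_Pair1[OF _ measurable_increment[of \<epsilon> K], of s] by simp
  have "(\<integral>\<^sup>+\<omega>. ennreal (exp (increment \<epsilon> K s (Z \<omega>))) \<partial>M)
      = (\<integral>\<^sup>+z. ennreal (exp (increment \<epsilon> K s z)) \<partial>distr M borel Z)"
    using m Z(1) by (subst nn_integral_distr) auto
  also have "\<dots> = (\<integral>\<^sup>+\<omega>. ennreal (exp (increment \<epsilon> K s (X \<omega>, y \<omega>))) \<partial>M)"
    unfolding Z(2) using m by (subst nn_integral_distr) auto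
  also have "\<dots> \<le> 1"
  proof (cases "norm (\<theta> - \<theta>s) \<le> \<epsilon>")
    case True
    have v: "(\<lambda>\<omega>. \<bar>X \<omega> \<bullet> (P *v X \<omega>)\<bar> / (1 + \<bar>X \<omega> \<bullet> (P *v X \<omega>)\<bar>)) \<in> borel_measurable (sigma_of M X)"
      by measurable
    show ?thesis
      using nn_integral_exp_increment_le_1[OF True v _ _ K] True
      by (simp add: s increment_def Let_def)
  next
    case False
    then show ?thesis by (simp add: s increment_def Let_def emeasure_space_1)
  qed
  finally show ?thesis .
qed

end

theorem theorem2:
  fixes M :: "'w measure"
    and X :: "'w \<Rightarrow> real ^ 'd" and y :: "'w \<Rightarrow> real"
    and Xs :: "nat \<Rightarrow> 'w \<Rightarrow> real ^ 'd" and ys :: "nat \<Rightarrow> 'w \<Rightarrow> real"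
    and \<X> :: "(real ^ 'd) set" and \<Y> :: "real set"
    and P1 :: "real ^ 'd ^ 'd" and \<theta>1 :: "real ^ 'd"
    and P :: "nat \<Rightarrow> 'w \<Rightarrow> real ^ 'd ^ 'd" and \<theta>h :: "nat \<Rightarrow> 'w \<Rightarrow> real ^ 'd"
    and \<theta>s :: "real ^ 'd"
    and DX \<sigma> Dapp :: real
    and \<tau> :: "real \<Rightarrow> real \<Rightarrow> nat"
    and \<delta> \<epsilon> :: real
  assumes "prob_space M"
    and "X \<in> borel_measurable M" and "y \<in> borel_measurable M"
    and "AE \<omega> in M. X \<omega> \<in> \<X> \<and> y \<omega> \<in> \<Y>"
    and "\<And>t. 1 \<le> t \<Longrightarrow> AE \<omega> in M. Xs t \<omega> \<in> \<X> \<and> ys t \<omega> \<in> \<Y>"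
    and "pos_def P1"
    and kalman: "\<And>\<omega>. \<omega> \<in> space M \<Longrightarrow>
      static_kalman P1 \<theta>1 (\<lambda>t. Xs t \<omega>) (\<lambda>t. ys t \<omega>) (\<lambda>t. P t \<omega>) (\<lambda>t. \<theta>h t \<omega>)"
    and i: "iid_copies M Xs ys X y"
      "pos_def (\<integral>\<omega>. outer (X \<omega>) \<partial>M)"
      "\<And>x. x \<in> \<X> \<Longrightarrow> norm x \<le> DX"
    and ii: "risk M X y \<theta>s = (INF \<theta>. risk M X y \<theta>)"
    and iii: "0 < \<sigma>" "cond_subgaussian M X y \<sigma>"
      "0 \<le> Dapp" "AE \<omega> in M. \<bar>cond_mean M X y \<omega> - \<theta>s \<bullet> X \<omega>\<bar> \<le> Dapp"
    and iv: "\<And>\<delta> \<epsilon>. 0 < \<delta> \<Longrightarrow> 0 < \<epsilon> \<Longrightarrow>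
      measure M {\<omega> \<in> space M. \<forall>t > \<tau> \<epsilon> \<delta>. norm (\<theta>h t \<omega> - \<theta>s) \<le> \<epsilon>} \<ge> 1 - \<delta>"
    and "0 < \<delta>" and "0 < \<epsilon>"
  shows "measure M {\<omega> \<in> space M. \<forall>n\<ge>1.
      (\<Sum>t = \<tau> \<epsilon> \<delta> + 1..\<tau> \<epsilon> \<delta> + n. risk M X y (\<theta>h t \<omega>) - risk M X y \<theta>s)
      \<le> 15 / 2 * real CARD('d) * (8 * \<sigma>\<^sup>2 + Dapp\<^sup>2 + \<epsilon>\<^sup>2 * DX\<^sup>2)
            * ln (1 + real n * (lambda_max P1 * DX\<^sup>2 / real CARD('d)))
        + 5 * lambda_max (matrix_inv (P (\<tau> \<epsilon> \<delta> + 1) \<omega>)) * \<epsilon>\<^sup>2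
        + 115 * (\<sigma>\<^sup>2 * (4 + lambda_max P1 * DX\<^sup>2 / 4) + Dapp\<^sup>2 + 2 * \<epsilon>\<^sup>2 * DX\<^sup>2)
            * ln (inverse \<delta>)}
    \<ge> 1 - 5 * \<delta>"
    (is "measure M ?T \<ge> _")
proof (cases "\<delta> \<le> 1")
  \<comment> \<open>For \<open>\<delta> > 1\<close> the claimed probability is negative. The main
    argument relies on \<open>ln (inverse \<delta>)\<close> being nonnegative.\<close>
  case False
  then have "1 - 5 * \<delta> \<le> 0" by simp
  then show ?thesis by (rule order_trans) simp
next
  case True
  note P1 = \<open>pos_def P1\<close>
  have risk_nonneg: "0 \<le> risk M X y \<theta>" for \<theta>
    by (simp add: risk_def quad_loss_def)
  have "risk M X y \<theta>s \<le> risk M X y \<theta>" for \<theta>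
    unfolding ii by (rule cINF_lower) (auto intro: bdd_belowI2[where m = 0] risk_nonneg)
  moreover have "AE \<omega> in M. norm (X \<omega>) \<le> DX"
    using assms(4) by eventually_elim (use i(3) in blast)
  ultimately interpret subgaussian_linear_model M X y \<theta>s DX \<sigma> Dapp
    using assms(1-3) iii by (intro subgaussian_linear_model.intro subgaussian_linear_model_axioms.intro) auto
  define m where "m = \<tau> \<epsilon> \<delta>"
  define B where "B = \<epsilon>\<^sup>2 * DX\<^sup>2"
  define K where "K = 230 * (4 * \<sigma>\<^sup>2 + Dapp\<^sup>2 + 2 * (\<epsilon>\<^sup>2 * DX\<^sup>2))"
  define c where "c = ln (inverse \<delta>)"
  define Z where "Z t \<omega> = (Xs t \<omega>, ys t \<omega>)" for t \<omega>
  \<comment> \<open>Increments are switched on at \<open>k = m\<close>, that is at time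
    \<open>Suc m\<close>, so a maximal inequality started at 0 bounds exactly the sums over times
    after \<open>m\<close>.\<close>
  define w where "w k s z = (if m \<le> k then increment \<epsilon> K s z else 0)" for k :: nat and s z
  define L where "L = lambda_max P1 * DX\<^sup>2"
  have L0: "0 \<le> L" using lambda_max_pos[OF P1] by (simp add: L_def)
  have c0: "0 \<le> c" using True \<open>0 < \<delta>\<close> by (simp add: c_def one_le_inverse)
  have K0: "0 < K" using \<sigma> by (simp add: K_def add_pos_nonneg)
  have ind: "indep_vars (\<lambda>_. borel) Z {1..}" and distZ: "\<And>t. 1 \<le> t \<Longrightarrow> distr M borel (Z t) = distr M borel (\<lambda>\<omega>. (X \<omega>, y \<omega>))"
    using i(1) by (auto simp: iid_copies_def Z_def[abs_def])
  have Zm: "Z t \<in> borel_measurable M" if "1 \<le> t" for t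
    using ind that by (auto simp: indep_vars_def)
  have [measurable]: "Xs t \<in> borel_measurable M" if "1 \<le> t" for t
    using borel_measurable_fst[OF Zm[OF that]] by (simp add: Z_def)
  have state: "state_seq (\<lambda>_. kalman_step) (\<theta>1, P1) (\<lambda>t. Z t \<omega>) k = (\<theta>h (Suc k) \<omega>, P (Suc k) \<omega>)"
    if "\<omega> \<in> space M" for \<omega> k
    using state_seq_kalman[OF kalman[OF that]] by (simp add: Z_def)
  have theta_meas[measurable]: "\<theta>h t \<in> borel_measurable M" if "1 \<le> t" for t
  proof -
    have "(\<lambda>\<omega>. fst (state_seq (\<lambda>_. kalman_step) (\<theta>1, P1) (\<lambda>t. Z t \<omega>) (t - 1))) \<in> borel_measurable M"
      by (intro borel_measurable_fst measurable_state_seq[OF measurable_kalman_step]) (auto intro: Zm)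
    then show ?thesis
      by (rule measurable_cong[THEN iffD1, rotated]) (use that state in simp)
  qed
  have wm: "case_prod (w k) \<in> borel_measurable (borel \<Otimes>\<^sub>M borel)" for k
    using measurable_increment[of \<epsilon> K] by (cases "m \<le> k") (simp_all add: w_def[abs_def] case_prod_beta')
  have "(\<integral>\<^sup>+\<omega>. ennreal (exp (w k s (Z (Suc k) \<omega>))) \<partial>M) \<le> 1" for k s
    using nn_integral_exp_increment[OF K_def Zm[of "Suc k"] distZ[of "Suc k"]]
    by (cases "m \<le> k") (auto simp: w_def emeasure_space_1)
  note max = this
  obtain A where A: "A \<in> sets M" "emeasure M A \<le> ennreal (exp (- c))"
    "{\<omega> \<in> space M. \<exists>n. c \<le> (\<Sum>k<n. w k (state_seq (\<lambda>_. kalman_step) (\<theta>1, P1) (\<lambda>i. Z i \<omega>) k) (Z (Suc k) \<omega>))} \<subseteq> A"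
    using state_seq_exp_maximal[where F = "\<lambda>_. kalman_step" and s = "(\<theta>1, P1)" and c = c,
        OF ind measurable_kalman_step _ wm max] by auto
  \<comment> \<open>The threshold \<open>c\<close> was chosen to make \<open>exp (- c)\<close> equal
    to \<open>\<delta>\<close>.\<close>
  have probA: "prob A \<le> \<delta>"
    using A(2) \<open>0 < \<delta>\<close> by (simp add: c_def ln_inverse emeasure_eq_measure)
  define G where "G = {\<omega> \<in> space M. \<forall>t > m. norm (\<theta>h t \<omega> - \<theta>s) \<le> \<epsilon>}"
  have G: "G \<in> sets M"
  proof -
    have "G = {\<omega> \<in> space M. \<forall>k. norm (\<theta>h (Suc (m + k)) \<omega> - \<theta>s) \<le> \<epsilon>}"
      unfolding G_def by (auto simp: less_iff_Suc_add)
    also have "\<dots> \<in> sets M" by measurable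
    finally show ?thesis .
  qed
  have probG: "1 - \<delta> \<le> prob G"
    using iv[OF \<open>0 < \<delta>\<close> \<open>0 < \<epsilon>\<close>] by (simp add: G_def m_def)
  \<comment> \<open>The comparison up to null sets at the end requires a measurable target. Writing
    the inverse matrix as the information matrix, a sum of outer products, makes its measurability
    immediate.\<close>
  have T: "?T \<in> sets M"
  proof -
    have Pinv: "matrix_inv (P (Suc m) \<omega>) = matrix_inv P1 + (\<Sum>s = 1..<Suc m. outer (Xs s \<omega>))"
      if "\<omega> \<in> space M" for \<omega>
      by (rule static_kalman_pos_def(2)[OF kalman[OF that] P1]) simp
    have sym: "transpose (matrix_inv (P (Suc m) \<omega>)) = matrix_inv (P (Suc m) \<omega>)"
      if "\<omega> \<in> space M" for \<omega>
    proof -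
      have "pos_def (P (Suc m) \<omega>)" by (rule static_kalman_pos_def(1)[OF kalman[OF that] P1]) simp
      from pos_def_matrix_inv(3)[OF this] show ?thesis by (simp add: pos_def_def)
    qed
    have "(\<lambda>\<omega>. matrix_inv P1 + (\<Sum>s = 1..<Suc m. outer (Xs s \<omega>))) \<in> borel_measurable M"
      by (intro borel_measurable_add borel_measurable_sum borel_measurable_outer) auto
    then have "(\<lambda>\<omega>. matrix_inv (P (Suc m) \<omega>)) \<in> borel_measurable M"
      by (rule measurable_cong[THEN iffD1, rotated]) (simp add: Pinv)
    from borel_measurable_lambda_max[OF this sym]
    have l: "(\<lambda>\<omega>. lambda_max (matrix_inv (P (\<tau> \<epsilon> \<delta> + 1) \<omega>))) \<in> borel_measurable M"
      by (simp add: m_def)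
    have f: "(\<lambda>\<omega>. (\<Sum>t = \<tau> \<epsilon> \<delta> + 1..\<tau> \<epsilon> \<delta> + n. risk M X y (\<theta>h t \<omega>) - risk M X y \<theta>s)) \<in> borel_measurable M" for n
      unfolding excess_risk
      by (intro borel_measurable_sum borel_measurable_divide borel_measurable_const
          measurable_compose[OF _ second_moment_measurable] borel_measurable_diff theta_meas) auto
    have "{\<omega> \<in> space M. \<forall>n\<ge>1. f n \<omega> \<le> a n + 5 * l \<omega> * \<epsilon>\<^sup>2 + b} \<in> sets M"
      if [measurable]: "\<And>n. f n \<in> borel_measurable M" "l \<in> borel_measurable M"
      for f :: "nat \<Rightarrow> 'w \<Rightarrow> real" and a :: "nat \<Rightarrow> real" and l b
      by measurable
    from this[OF f l] show ?thesis .
  qed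
  have bounded: "AE \<omega> in M. \<forall>t\<in>{1..}. norm (Xs t \<omega>) \<le> DX"
  proof (subst AE_ball_countable)
    show "\<forall>t\<in>{1..}. AE \<omega> in M. norm (Xs t \<omega>) \<le> DX"
    proof
      fix t :: nat assume "t \<in> {1..}"
      then have "AE \<omega> in M. Xs t \<omega> \<in> \<X> \<and> ys t \<omega> \<in> \<Y>" using assms(5) by simp
      then show "AE \<omega> in M. norm (Xs t \<omega>) \<le> DX" by eventually_elim (use i(3) in blast)
    qed
  qed simp
  \<comment> \<open>From here on the argument is deterministic, one outcome at a time:
    \<open>\<omega>\<close> has close estimates after time \<open>m\<close> and partial sums that
    stay below \<open>c\<close>.\<close>
  have in_T: "\<omega> \<in> ?T" if \<omega>: "\<omega> \<in> G - A" and D: "\<forall>t\<in>{1..}. norm (Xs t \<omega>) \<le> DX" for \<omega>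
  proof -
    have sp: "\<omega> \<in> space M" using \<omega> by (simp add: G_def)
    note kal = kalman[OF sp]
    define e where "e t = \<theta>h t \<omega> - \<theta>s" for t
    define u where "u t = e t \<bullet> Xs t \<omega>" for t
    define \<rho> where "\<rho> t = ys t \<omega> - \<theta>s \<bullet> Xs t \<omega>" for t
    define v where "v t = Xs t \<omega> \<bullet> (P (Suc t) \<omega> *v Xs t \<omega>)" for t
    define C where "C = 15 * (8 * \<sigma>\<^sup>2 + Dapp\<^sup>2 + \<epsilon>\<^sup>2 * DX\<^sup>2)"
    define E where "E t = second_moment (e t) - 5 * (u t)\<^sup>2 + 10 * (\<rho> t * u t) + 5 * (\<rho> t - u t)\<^sup>2 * v t - C * v t" for t
    define \<Lambda> where "\<Lambda> n = real CARD('d) * ln (1 + real n * (L / real CARD('d)))" for n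
    define l where "l = lambda_max (matrix_inv (P (Suc m) \<omega>))"
    have l_nonneg: "0 \<le> l"
    proof -
      have "pos_def (matrix_inv (P (Suc m) \<omega>))"
        using static_kalman_pos_def(1)[OF kal P1, of "Suc m"] by (intro pos_def_matrix_inv) simp
      then show ?thesis unfolding l_def by (rule lambda_max_pos[THEN less_imp_le])
    qed
    have e_le: "norm (e t) \<le> \<epsilon>" if "m < t" for t using \<omega> that by (simp add: G_def e_def)
    \<comment> \<open>On \<open>G\<close> the cut outside the ball does not act after time
      \<open>m\<close>, and the absolute values in \<open>increment\<close> disappear because
      \<open>P (Suc k) \<omega>\<close> is positive definite.\<close>
    have step: "w k (state_seq (\<lambda>_. kalman_step) (\<theta>1, P1) (\<lambda>i. Z i \<omega>) k) (Z (Suc k) \<omega>) = E (Suc k) / K"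
      if "m \<le> k" for k
    proof -
      have "0 \<le> Xs (Suc k) \<omega> \<bullet> (P (Suc k) \<omega> *v Xs (Suc k) \<omega>)"
        using static_kalman_pos_def(1)[OF kal P1, of "Suc k"] by (simp add: pos_def_nonneg)
      then have gain: "\<bar>Xs (Suc k) \<omega> \<bullet> (P (Suc k) \<omega> *v Xs (Suc k) \<omega>)\<bar>
          / (1 + \<bar>Xs (Suc k) \<omega> \<bullet> (P (Suc k) \<omega> *v Xs (Suc k) \<omega>)\<bar>) = v (Suc k)"
        using static_kalman_gain[OF kal P1, of "Suc k"] by (simp add: v_def)
      show ?thesis
        using that e_le[of "Suc k"]
        unfolding state[OF sp] unfolding w_def Z_def increment_def Let_def prod.case gain
        by (simp add: E_def C_def u_def \<rho>_def e_def)
    qed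
    have "(\<Sum>t = m + 1..m + n. risk M X y (\<theta>h t \<omega>) - risk M X y \<theta>s)
        \<le> C / 2 * \<Lambda> n + 5 * l * \<epsilon>\<^sup>2 + K / 2 * c" for n
    proof -
      have "\<not> c \<le> (\<Sum>k<m + n. w k (state_seq (\<lambda>_. kalman_step) (\<theta>1, P1) (\<lambda>i. Z i \<omega>) k) (Z (Suc k) \<omega>))"
        using \<omega> sp A(3) by blast
      moreover have "(\<Sum>k<m + n. w k (state_seq (\<lambda>_. kalman_step) (\<theta>1, P1) (\<lambda>i. Z i \<omega>) k) (Z (Suc k) \<omega>))
          = (\<Sum>k = m..<m + n. E (Suc k) / K)"
      proof -
        have "(\<Sum>k<m + n. w k (state_seq (\<lambda>_. kalman_step) (\<theta>1, P1) (\<lambda>i. Z i \<omega>) k) (Z (Suc k) \<omega>))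
          = (\<Sum>k = m..<m + n. w k (state_seq (\<lambda>_. kalman_step) (\<theta>1, P1) (\<lambda>i. Z i \<omega>) k) (Z (Suc k) \<omega>))"
          by (rule sum.mono_neutral_right) (auto simp: w_def)
        also have "\<dots> = (\<Sum>k = m..<m + n. E (Suc k) / K)"
          by (intro sum.cong refl step) simp
        finally show ?thesis .
      qed
      moreover have "(\<Sum>k = m..<m + n. E (Suc k) / K) = (\<Sum>t = Suc m..<Suc m + n. E t) / K"
        unfolding sum_divide_distrib add_Suc sum.shift_bounds_Suc_ivl ..
      ultimately have "(\<Sum>t = Suc m..<Suc m + n. E t) / K \<le> c" by linarith
      then have E_le: "(\<Sum>t = Suc m..<Suc m + n. E t) \<le> K * c"
        using K0 by (simp add: divide_le_eq mult.commute)
      have energy: "(\<Sum>t = Suc m..<Suc m + n. (u t)\<^sup>2 - 2 * \<rho> t * u t - (\<rho> t - u t)\<^sup>2 * v t) \<le> l * \<epsilon>\<^sup>2"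
      proof -
        have "(\<Sum>t = Suc m..<Suc m + n. (u t)\<^sup>2 - 2 * \<rho> t * u t - (\<rho> t - u t)\<^sup>2 * v t) \<le> l * (norm (e (Suc m)))\<^sup>2"
          using static_kalman_energy_sum[OF kal P1, of "Suc m" \<theta>s n]
          by (simp add: u_def \<rho>_def v_def e_def l_def inner_diff_left)
        also have "\<dots> \<le> l * \<epsilon>\<^sup>2"
          using e_le[of "Suc m"] l_nonneg by (intro mult_left_mono power_mono) auto
        finally show ?thesis .
      qed
      have gain: "(\<Sum>t = Suc m..<Suc m + n. v t) \<le> \<Lambda> n"
        using static_kalman_gain_sum[OF kal P1, of "Suc m" DX n] D by (simp add: v_def \<Lambda>_def L_def)
      \<comment> \<open>Adding five times the energy drop and \<open>C\<close> times the gain to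
        \<open>E t\<close> returns the second moment, and each of the three sums has its own
        bound.\<close>
      have "(\<Sum>t = Suc m..<Suc m + n. second_moment (e t))
          = (\<Sum>t = Suc m..<Suc m + n. E t + 5 * ((u t)\<^sup>2 - 2 * \<rho> t * u t - (\<rho> t - u t)\<^sup>2 * v t) + C * v t)"
        by (intro sum.cong refl) (simp add: E_def algebra_simps)
      also have "\<dots> = (\<Sum>t = Suc m..<Suc m + n. E t)
          + 5 * (\<Sum>t = Suc m..<Suc m + n. (u t)\<^sup>2 - 2 * \<rho> t * u t - (\<rho> t - u t)\<^sup>2 * v t)
          + C * (\<Sum>t = Suc m..<Suc m + n. v t)"
        by (simp only: sum.distrib sum_distrib_left)
      also have "\<dots> \<le> K * c + 5 * (l * \<epsilon>\<^sup>2) + C * \<Lambda> n"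
        using E_le energy gain by (intro add_mono mult_left_mono) (auto simp: C_def)
      finally have "(\<Sum>t = Suc m..<Suc m + n. second_moment (e t)) / 2 \<le> (K * c + 5 * (l * \<epsilon>\<^sup>2) + C * \<Lambda> n) / 2"
        by simp
      \<comment> \<open>Halving gives \<open>5 / 2 * l * \<epsilon>\<^sup>2\<close>, which is
        enlarged to the stated coefficient.\<close>
      also have "\<dots> \<le> C / 2 * \<Lambda> n + 5 * l * \<epsilon>\<^sup>2 + K / 2 * c" using l_nonneg by simp
      also have "(\<Sum>t = Suc m..<Suc m + n. second_moment (e t)) / 2
          = (\<Sum>t = m + 1..m + n. risk M X y (\<theta>h t \<omega>) - risk M X y \<theta>s)"
        unfolding excess_risk sum_divide_distrib e_def
        by (intro sum.cong) auto
      finally show ?thesis .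
    qed
    \<comment> \<open>\<open>K / 2\<close> is \<open>115 * (4 * \<sigma>\<^sup>2 + Dapp\<^sup>2 + 2
      * \<epsilon>\<^sup>2 * DX\<^sup>2)\<close>; adding \<open>\<sigma>\<^sup>2 * L / 4\<close> in
      the bracket enlarges the bound since \<open>L\<close> and \<open>c\<close> are
      nonnegative.\<close>
    moreover have "K / 2 * c \<le> 115 * (\<sigma>\<^sup>2 * (4 + L / 4) + Dapp\<^sup>2 + 2 * \<epsilon>\<^sup>2 * DX\<^sup>2) * c"
      using c0 L0 by (intro mult_right_mono) (auto simp: K_def algebra_simps)
    ultimately have "(\<Sum>t = m + 1..m + n. risk M X y (\<theta>h t \<omega>) - risk M X y \<theta>s)
        \<le> C / 2 * \<Lambda> n + 5 * l * \<epsilon>\<^sup>2 + 115 * (\<sigma>\<^sup>2 * (4 + L / 4) + Dapp\<^sup>2 + 2 * \<epsilon>\<^sup>2 * DX\<^sup>2) * c" for n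
      by (meson add_left_mono order_trans)
    then show ?thesis
      using sp by (simp add: m_def C_def \<Lambda>_def L_def l_def c_def mult_ac)
  qed
  have "AE \<omega> in M. \<omega> \<in> G - A \<longrightarrow> \<omega> \<in> ?T"
    using bounded by (rule eventually_mono) (intro impI in_T)
  then have "prob (G - A) \<le> prob ?T" using T by (rule finite_measure_mono_AE)
  moreover have "prob G \<le> prob (G - A) + prob A"
  proof -
    have "prob G \<le> prob ((G - A) \<union> A)" using G A(1) by (intro finite_measure_mono) auto
    also have "\<dots> \<le> prob (G - A) + prob A" using G A(1) by (intro measure_Un_le) auto
    finally show ?thesis .
  qed
  \<comment> \<open>The complement of \<open>G\<close> and the set \<open>A\<close> each cost at
    most \<open>\<delta>\<close>, which stays within the allowed
    \<open>5 * \<delta>\<close>.\<close>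
  ultimately show ?thesis using probG probA \<open>0 < \<delta>\<close> by linarith
qed

end
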